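(* The translation of CGV into APCP preserves typing (up to priority requirements): (1) For every derivation of $\Gamma\vdash_{\mathtt M}M:T$, its translation $[\![M]\!]z$ satisfies $[\![M]\!]z\vdash^{*}\overline{[\![\Gamma]\!]},\,z:[\![T]\!]$. (2) For every derivation of $\Gamma\vdash_{\mathtt C}^{\phi}C:T$, its translation $[\![C]\!]z$ satisfies $[\![C]\!]z\vdash^{*}\overline{[\![\Gamma]\!]},\,z:[\![T]\!]$. (3) For every derivation of $\Gamma\vdash_{\mathtt B}[\vec m\rangle:S'>S$ and every process $P$ with $P\vdash^{*}\Lambda,\,x:\overline{[\![S']\!]}$, the translation $[\![\,[\vec m\rangle\,]\!]_x^{P}$ satisfies $[\![\,[\vec m\rangle\,]\!]_x^{P}\vdash^{*}\overline{[\![\Gamma]\!]},\,\Lambda,\,x:\overline{[\![S]\!]}$.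
   Context: **CGV terms.** Runtime terms, with $x,y$ variables, $\ell,i,j$ labels, $I$ a set of labels: $M,N ::= x \mid () \mid \lambda x.M \mid M\,N \mid (M,N) \mid \mathsf{let}\,(x,y)=M\,\mathsf{in}\,N \mid \mathsf{new} \mid \mathsf{spawn}\,M \mid \mathsf{send}\,M \mid \mathsf{recv}\,M \mid \mathsf{select}\,\ell\,M \mid \mathsf{case}\,M\,\mathsf{of}\,\{i:N_i\}_{i\in I} \mid M\{\!\{N/x\}\!\} \mid \mathsf{send}'(M,N)$; $M\{\!\{N/x\}\!\}$ is an explicit substitution. Markers $\phi ::= \mathsf{main}\mid\lozenge$; messages $m ::= M\mid\ell$; configurations $C,D ::= \phi\,M \mid C\parallel D \mid (\nu x[\vec m\rangle y)C \mid C\{\!\{M/x\}\!\}$, with $\vec m$ a finite sequence of messages ($\epsilon$ empty). **CGV types.** $T,U ::= T\times U \mid T\multimap U \mid \mathbf 1 \mid S$; session types $S ::= {!}T.S \mid {?}T.S \mid \oplus\{i:S_i\}_{i\in I} \mid \&\{i:S_i\}_{i\in I} \mid \mathsf{end}$. Duality: $\overline{{!}T.S}={?}T.\overline S$, $\overline{{?}T.S}={!}T.\overline S$, $\overline{\oplus\{i:S_i\}}=\&\{i:\overline{S_i}\}$, $\overline{\&\{i:S_i\}}=\oplus\{i:\overline{S_i}\}$, $\overline{\mathsf{end}}=\mathsf{end}$. Environments $\Gamma,\Delta$ assign types to distinct variables. **Term typing**: (T-Var) $x:T\vdash_{\mathtt M}x:T$. (T-Abs) $\Gamma,x:T\vdash_{\mathtt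 M}M:U$ gives $\Gamma\vdash_{\mathtt M}\lambda x.M:T\multimap U$. (T-App) $\Gamma\vdash_{\mathtt M}M:T\multimap U$, $\Delta\vdash_{\mathtt M}N:T$ give $\Gamma,\Delta\vdash_{\mathtt M}M\,N:U$. (T-Unit) $\emptyset\vdash_{\mathtt M}():\mathbf 1$. (T-Pair) $\Gamma\vdash_{\mathtt M}M:T$, $\Delta\vdash_{\mathtt M}N:U$ give $\Gamma,\Delta\vdash_{\mathtt M}(M,N):T\times U$. (T-Split) $\Gamma\vdash_{\mathtt M}M:T\times T'$, $\Delta,x:T,y:T'\vdash_{\mathtt M}N:U$ give $\Gamma,\Delta\vdash_{\mathtt M}\mathsf{let}\,(x,y)=M\,\mathsf{in}\,N:U$. (T-New) $\emptyset\vdash_{\mathtt M}\mathsf{new}:S\times\overline S$. (T-Spawn) $\Gamma\vdash_{\mathtt M}M:\mathbf 1\times T$ gives $\Gamma\vdash_{\mathtt M}\mathsf{spawn}\,M:T$. (T-EndL) $\Gamma\vdash_{\mathtt M}M:T$ gives $\Gamma,x:\mathsf{end}\vdash_{\mathtt M}M:T$. (T-EndR) $\emptyset\vdash_{\mathtt M}x:\mathsf{end}$. (T-Send) $\Gamma\vdash_{\mathtt M}M:T\times{!}T.S$ gives $\Gamma\vdash_{\mathtt M}\mathsf{send}\,M:S$. (T-Recv) $\Gamma\vdash_{\mathtt M}M:{?}T.S$ gives $\Gamma\vdash_{\mathtt M}\mathsf{recv}\,M:T\times S$. (T-Select) $\Gamma\vdash_{\mathtt M}M:\oplus\{i:S_i\}_{i\in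 I}$, $j\in I$ give $\Gamma\vdash_{\mathtt M}\mathsf{select}\,j\,M:S_j$. (T-Case) $\Gamma\vdash_{\mathtt M}M:\&\{i:S_i\}_{i\in I}$ and $\Delta\vdash_{\mathtt M}N_i:S_i\multimap U$ for all $i\in I$ give $\Gamma,\Delta\vdash_{\mathtt M}\mathsf{case}\,M\,\mathsf{of}\,\{i:N_i\}_{i\in I}:U$. (T-Sub) $\Gamma,x:T\vdash_{\mathtt M}M:U$, $\Delta\vdash_{\mathtt M}N:T$ give $\Gamma,\Delta\vdash_{\mathtt M}M\{\!\{N/x\}\!\}:U$. (T-Send') $\Gamma\vdash_{\mathtt M}M:T$, $\Delta\vdash_{\mathtt M}N:{!}T.S$ give $\Gamma,\Delta\vdash_{\mathtt M}\mathsf{send}'(M,N):S$. **Buffer typing**: (T-Buf) $\emptyset\vdash_{\mathtt B}[\epsilon\rangle:S'>S'$. (T-BufSend) $\Gamma\vdash_{\mathtt M}M:T$, $\Delta\vdash_{\mathtt B}[\vec m\rangle:S'>S$ give $\Gamma,\Delta\vdash_{\mathtt B}[\vec m,M\rangle:S'>{!}T.S$. (T-BufSelect) $\Gamma\vdash_{\mathtt B}[\vec m\rangle:S'>S_j$, $j\in I$ give $\Gamma\vdash_{\mathtt B}[\vec m,j\rangle:S'>\oplus\{i:S_i\}_{i\in I}$. **Configuration typing**, with $\mathsf{main}+\lozenge=\lozenge+\mathsf{main}=\mathsf{main}$, $\lozenge+\lozenge=\lozenge$, $\mathsf{main}+\mathsf{main}$ undefined: (T-Main) $\Gamma\vdash_{\mathtt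 M}M:T$ gives $\Gamma\vdash_{\mathtt C}^{\mathsf{main}}\mathsf{main}\,M:T$. (T-Child) $\Gamma\vdash_{\mathtt M}M:\mathbf 1$ gives $\Gamma\vdash_{\mathtt C}^{\lozenge}\lozenge\,M:\mathbf 1$. (T-ParL) $\Gamma\vdash_{\mathtt C}^{\lozenge}C:\mathbf 1$, $\Delta\vdash_{\mathtt C}^{\phi}D:T$ give $\Gamma,\Delta\vdash_{\mathtt C}^{\lozenge+\phi}C\parallel D:T$. (T-ParR) $\Gamma\vdash_{\mathtt C}^{\phi}C:T$, $\Delta\vdash_{\mathtt C}^{\lozenge}D:\mathbf 1$ give $\Gamma,\Delta\vdash_{\mathtt C}^{\phi+\lozenge}C\parallel D:T$. (T-Res) $\Gamma\vdash_{\mathtt B}[\vec m\rangle:S'>S$, $\Delta,x:S',y:\overline S\vdash_{\mathtt C}^{\phi}C:T$ give $\Gamma,\Delta\vdash_{\mathtt C}^{\phi}(\nu x[\vec m\rangle y)C:T$. (T-ResBuf) $\Gamma,y:\overline S\vdash_{\mathtt B}[\vec m\rangle:S'>S$, $\Delta,x:S'\vdash_{\mathtt C}^{\phi}C:T$ give $\Gamma,\Delta\vdash_{\mathtt C}^{\phi}(\nu x[\vec m\rangle y)C:T$. (T-ConfSub) $\Gamma,x:T\vdash_{\mathtt C}^{\phi}C:U$, $\Delta\vdash_{\mathtt M}M:T$ give $\Gamma,\Delta\vdash_{\mathtt C}^{\phi}C\{\!\{M/x\}\!\}:U$. **APCP processes.** $P,Q ::= x[y,z] \mid x(y,z).P \mid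 x[z]\triangleleft i \mid x(z)\triangleright\{i:P_i\}_{i\in I} \mid (\nu xy)P \mid P\mid Q \mid \mathbf 0 \mid x\leftrightarrow y$. Some restrictions are written $(\nu^{\leftrightarrow}xy)P$ (an annotation irrelevant for typing). APCP session types (with $\wp$ the linear-logic "par"): $A,B ::= A\otimes B \mid A\wp B \mid \oplus\{i:A_i\}_{i\in I} \mid \&\{i:A_i\}_{i\in I} \mid \bullet$; dual: $\overline{A\otimes B}=\overline A\wp\overline B$, $\overline{A\wp B}=\overline A\otimes\overline B$, $\overline{\oplus\{i:A_i\}}=\&\{i:\overline{A_i}\}$, $\overline{\&\{i:A_i\}}=\oplus\{i:\overline{A_i}\}$, $\overline\bullet=\bullet$. (In full APCP the connectives carry priority annotations; they are disregarded here.) The judgment $P\vdash^{*}\Gamma$ is APCP typing with all priority checks erased; $\Gamma$ is a linear context up to reordering: $\mathbf 0\vdash^{*}\emptyset$; $P\vdash^{*}\Gamma$ gives $P\vdash^{*}\Gamma,x:\bullet$; $x\leftrightarrow y\vdash^{*}x:\overline A,y:A$; $P\vdash^{*}\Gamma$, $Q\vdash^{*}\Delta$ give $P\mid Q\vdash^{*}\Gamma,\Delta$; $P\vdash^{*}\Gamma,x:A,y:\overline A$ gives $(\nu xy)P\vdash^{*}\Gamma$; $x[y,z]\vdash^{*}x:A\otimes B,y:\overline A,z:\overline B$; $P\vdash^{*}\Gamma,y:A,z:B$ gives $x(y,z).P\vdash^{*}\Gamma,x:A\wp B$; for $j\in I$, $x[z]\triangleleft j\vdash^{*}x:\oplus\{i:A_i\}_{i\in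 I},z:\overline{A_j}$; $P_i\vdash^{*}\Gamma,z:A_i$ for all $i\in I$ gives $x(z)\triangleright\{i:P_i\}_{i\in I}\vdash^{*}\Gamma,x:\&\{i:A_i\}_{i\in I}$. **Translation of types.** $[\![T\times U]\!]=([\![T]\!]\wp\bullet)\otimes([\![U]\!]\wp\bullet)$; $[\![T\multimap U]\!]=(\overline{[\![T]\!]}\otimes\bullet)\wp[\![U]\!]$; $[\![\mathbf 1]\!]=[\![\mathsf{end}]\!]=\bullet$; $[\![{!}T.S]\!]=(\overline{[\![T]\!]}\otimes\bullet)\wp[\![S]\!]$; $[\![{?}T.S]\!]=([\![T]\!]\wp\bullet)\otimes[\![S]\!]$; $[\![\oplus\{i:S_i\}]\!]=\&\{i:[\![S_i]\!]\}$; $[\![\&\{i:S_i\}]\!]=\oplus\{i:[\![S_i]\!]\}$. Extended pointwise to environments; $\overline{\Gamma}$ dualizes each type. **Translation of terms** $[\![M]\!]z$ (defined by recursion on the typing derivation, by last rule; newly introduced names are fresh): T-Var: $x\leftrightarrow z$. T-Unit: $\mathbf 0$. T-Abs: $z(a,b).(\nu^{\leftrightarrow}cx)((\nu ef)a[c,e]\mid[\![M]\!]b)$. T-App: $(\nu ab)([\![M]\!]a\mid(\nu cd)(b[c,z]\mid d(e,f).[\![N]\!]e))$. T-Pair: $(\nu ab)(\nu cd)(z[a,c]\mid b(e,f).[\![M]\!]e\mid d(g,h).[\![N]\!]g)$. T-Split: $(\nu ab)([\![M]\!]a\mid b(c,d).(\nu^{\leftrightarrow}ex)(\nu^{\leftrightarrow}fy)((\nu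 gh)c[e,g]\mid(\nu kl)d[f,k]\mid[\![N]\!]z))$. T-New: $(\nu ab)((\nu cd)a[c,d]\mid b(e,f).(\nu xy)[\![(x,y)]\!]z)$ (with $x:S,y:\overline S$). T-Spawn: $(\nu ab)([\![M]\!]a\mid b(c,d).((\nu ef)c[e,f]\mid(\nu gh)d[z,g]))$. T-EndL: $[\![M]\!]z$. T-EndR: $\mathbf 0$. T-Send: $(\nu ab)([\![M]\!]a\mid b(c,d).(\nu ef)((\nu gh)d[e,g]\mid(\nu kl)(f[c,k]\mid l\leftrightarrow z)))$. T-Recv: $(\nu ab)([\![M]\!]a\mid b(c,d).(\nu ef)(z[c,e]\mid f(g,h).d\leftrightarrow g))$. T-Select: $(\nu ab)([\![M]\!]a\mid(\nu cd)(b[c]\triangleleft j\mid d\leftrightarrow z))$. T-Case: $(\nu ab)([\![M]\!]a\mid b(c)\triangleright\{i:[\![N_i\,c]\!]z\}_{i\in I})$. T-Sub: $(\nu^{\leftrightarrow}xa)([\![M]\!]z\mid[\![N]\!]a)$. T-Send': $(\nu ab)(a(c,d).[\![M]\!]c\mid(\nu ef)([\![N]\!]e\mid(\nu gh)(f[b,g]\mid h\leftrightarrow z)))$. **Translation of buffers** $[\![\,[\vec m\rangle\,]\!]_x^{P}$, for a continuation process $P$ with $P\vdash^{*}\Lambda,x:\overline{[\![S']\!]}$: T-Buf: $P$. T-BufSend (for $[\vec m,M\rangle$): $(\nu ab)(\nu cd)((\nu gh)(x\leftrightarrow g\mid h[a,c])\mid b(e,f).[\![M]\!]e\mid[\![\,[\vec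 m\rangle\,]\!]_d^{P\{d/x\}})$. T-BufSelect (for $[\vec m,j\rangle$): $(\nu ab)((\nu cd)(x\leftrightarrow c\mid d[a]\triangleleft j)\mid[\![\,[\vec m\rangle\,]\!]_b^{P\{b/x\}})$. **Translation of configurations** $[\![C]\!]z$: T-Main/T-Child: $[\![\phi\,M]\!]z=[\![M]\!]z$. T-ParL: $(\nu ab)[\![C]\!]a\mid[\![D]\!]z$. T-ParR: $[\![C]\!]z\mid(\nu ab)[\![D]\!]a$. T-Res/T-ResBuf: $(\nu xy)[\![\,[\vec m\rangle\,]\!]_x^{[\![C]\!]z}$. T-ConfSub: $(\nu^{\leftrightarrow}xa)([\![C]\!]z\mid[\![M]\!]a)$. *)

theory Defs
  imports Main "HOL-Library.Finite_Map"
begin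

section \<open>Names, labels, contexts\<close>

text \<open>
  CGV variables and APCP names are drawn from the same infinite set, since the translation
  reuses the variables of a term as names of the process. Families indexed by a finite set
  I of labels are finite maps with domain I.
\<close>

type_synonym name = nat
type_synonym label = string

text \<open>
  Contexts are finite maps, hence unordered and with distinct names. The comma of the paper
  presupposes disjointness; in the rules this is spelled out next to each use of
  \<^term>\<open>fmupd\<close> and \<^term>\<open>fmadd\<close>.
\<close>

abbreviation ext :: "('a, 'b) fmap \<Rightarrow> 'a \<Rightarrow> 'b \<Rightarrow> ('a, 'b) fmap"  ("_ ,, _ \<mapsto> _" [60, 61, 61] 60)
  where "\<Gamma> ,, x \<mapsto> T \<equiv> fmupd x T \<Gamma>"

abbreviation keys :: "('a, 'b) fmap \<Rightarrow> 'a set"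
  where "keys \<Gamma> \<equiv> fmdom' \<Gamma>"

section \<open>CGV: syntax and types\<close>

datatype trm =
    Var name
  | Unit
  | Lam name trm
  | App trm trm
  | Pair trm trm
  | Split name name trm trm                  \<comment> \<open>\<open>Split x y M N\<close> is let (x,y) = M in N\<close>
  | New
  | Spawn trm
  | Send trm
  | Recv trm
  | Select label trm
  | Case trm "(label, trm) fmap"
  | Sub trm trm name                         \<comment> \<open>\<open>Sub M N x\<close> is M{{N/x}}\<close>
  | Send' trm trm

datatype marker = Main_Thread | Child_Thread

datatype msg = MsgTerm trm | MsgLabel label

datatype conf =
    Thread marker trm
  | CPar conf conf
  | CRes name "msg list" name conf
  | CSub conf trm name                       \<comment> \<open>\<open>CSub C M x\<close> is C{{M/x}}\<close>

text \<open>Bound variables (of terms, messages, configurations).\<close>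

primrec bvM :: "trm \<Rightarrow> name set" where
  "bvM (Var x) = {}"
| "bvM Unit = {}"
| "bvM (Lam x M) = insert x (bvM M)"
| "bvM (App M N) = bvM M \<union> bvM N"
| "bvM (Pair M N) = bvM M \<union> bvM N"
| "bvM (Split x y M N) = {x, y} \<union> bvM M \<union> bvM N"
| "bvM New = {}"
| "bvM (Spawn M) = bvM M"
| "bvM (Send M) = bvM M"
| "bvM (Recv M) = bvM M"
| "bvM (Select l M) = bvM M"
| "bvM (Case M Ns) = bvM M \<union> \<Union> (fmran' (fmmap bvM Ns))"
| "bvM (Sub M N x) = insert x (bvM M \<union> bvM N)"
| "bvM (Send' M N) = bvM M \<union> bvM N"

primrec bvMsg :: "msg \<Rightarrow> name set" where
  "bvMsg (MsgTerm M) = bvM M"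
| "bvMsg (MsgLabel l) = {}"

definition bvB :: "msg list \<Rightarrow> name set" where
  "bvB ms = (\<Union>m \<in> set ms. bvMsg m)"

primrec bvC :: "conf \<Rightarrow> name set" where
  "bvC (Thread \<phi> M) = bvM M"
| "bvC (CPar C D) = bvC C \<union> bvC D"
| "bvC (CRes x ms y C) = {x, y} \<union> bvB ms \<union> bvC C"
| "bvC (CSub C M x) = insert x (bvC C \<union> bvM M)"

datatype ty =
    TProd ty ty
  | TFun ty ty
  | TUnit
  | TSess sty
and sty =
    SSend ty sty
  | SRecv ty sty
  | SPlus "(label, sty) fmap"
  | SWith "(label, sty) fmap"
  | SEnd

primrec sdual :: "sty \<Rightarrow> sty" where
  "sdual (SSend T S) = SRecv T (sdual S)"
| "sdual (SRecv T S) = SSend T (sdual S)"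
| "sdual (SPlus Ss) = SWith (fmmap sdual Ss)"
| "sdual (SWith Ss) = SPlus (fmmap sdual Ss)"
| "sdual SEnd = SEnd"

type_synonym env = "(name, ty) fmap"

section \<open>CGV: typing derivations\<close>

text \<open>
  The translation is defined on derivations, not on terms (a variable may be typed by T-Var or
  by T-EndR, and T-EndL is not syntax-directed). So derivations are represented as trees whose
  nodes are the names of the typing rules, with the variables bound by the rule, and the typing
  relations say which judgment a tree derives. The judgment of the paper without mention of a
  derivation is the existential closure over the tree.

  Terms are raw, i.e. not quotiented by renaming of bound variables. The usual convention that
  bound variables differ from the free variables around them appears as side conditions in the
  rules whose translation enlarges the scope of a bound variable: explicit substitution (both
  forms) and buffered restriction (both rules).
\<close>

datatype derM =
    D_Var name
  | D_Abs name derM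
  | D_App derM derM
  | D_Unit
  | D_Pair derM derM
  | D_Split name name derM derM
  | D_New
  | D_Spawn derM
  | D_EndL name derM
  | D_EndR name
  | D_Send derM
  | D_Recv derM
  | D_Select label derM
  | D_Case derM "(label, derM) fmap"
  | D_Sub derM derM name
  | D_Send' derM derM

inductive typM :: "derM \<Rightarrow> env \<Rightarrow> trm \<Rightarrow> ty \<Rightarrow> bool" where
  T_Var: "typM (D_Var x) (fmempty ,, x \<mapsto> T) (Var x) T"
| T_Abs: "\<lbrakk> typM d (\<Gamma> ,, x \<mapsto> T) M U; x \<notin> keys \<Gamma> \<rbrakk>
    \<Longrightarrow> typM (D_Abs x d) \<Gamma> (Lam x M) (TFun T U)"
| T_App: "\<lbrakk> typM d \<Gamma> M (TFun T U); typM e \<Delta> N T; keys \<Gamma> \<inter> keys \<Delta> = {} \<rbrakk>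
    \<Longrightarrow> typM (D_App d e) (\<Gamma> ++\<^sub>f \<Delta>) (App M N) U"
| T_Unit: "typM D_Unit fmempty Unit TUnit"
| T_Pair: "\<lbrakk> typM d \<Gamma> M T; typM e \<Delta> N U; keys \<Gamma> \<inter> keys \<Delta> = {} \<rbrakk>
    \<Longrightarrow> typM (D_Pair d e) (\<Gamma> ++\<^sub>f \<Delta>) (Pair M N) (TProd T U)"
| T_Split: "\<lbrakk> typM d \<Gamma> M (TProd T T'); typM e (\<Delta> ,, x \<mapsto> T ,, y \<mapsto> T') N U;
      x \<noteq> y; x \<notin> keys \<Delta>; y \<notin> keys \<Delta>; keys \<Gamma> \<inter> keys \<Delta> = {} \<rbrakk>
    \<Longrightarrow> typM (D_Split x y d e) (\<Gamma> ++\<^sub>f \<Delta>) (Split x y M N) U"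
| T_New: "typM D_New fmempty New (TProd (TSess S) (TSess (sdual S)))"
| T_Spawn: "typM d \<Gamma> M (TProd TUnit T) \<Longrightarrow> typM (D_Spawn d) \<Gamma> (Spawn M) T"
| T_EndL: "\<lbrakk> typM d \<Gamma> M T; x \<notin> keys \<Gamma> \<rbrakk>
    \<Longrightarrow> typM (D_EndL x d) (\<Gamma> ,, x \<mapsto> TSess SEnd) M T"
| T_EndR: "typM (D_EndR x) fmempty (Var x) (TSess SEnd)"
| T_Send: "typM d \<Gamma> M (TProd T (TSess (SSend T S)))
    \<Longrightarrow> typM (D_Send d) \<Gamma> (Send M) (TSess S)"
| T_Recv: "typM d \<Gamma> M (TSess (SRecv T S))
    \<Longrightarrow> typM (D_Recv d) \<Gamma> (Recv M) (TProd T (TSess S))"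
| T_Select: "\<lbrakk> typM d \<Gamma> M (TSess (SPlus Ss)); fmlookup Ss j = Some S \<rbrakk>
    \<Longrightarrow> typM (D_Select j d) \<Gamma> (Select j M) (TSess S)"
| T_Case: "\<lbrakk> typM d \<Gamma> M (TSess (SWith Ss));
      keys Ns = keys Ss; keys es = keys Ss;
      \<forall>i e N S. fmlookup es i = Some e \<longrightarrow> fmlookup Ns i = Some N \<longrightarrow> fmlookup Ss i = Some S
        \<longrightarrow> typM e \<Delta> N (TFun (TSess S) U);
      keys \<Gamma> \<inter> keys \<Delta> = {} \<rbrakk>
    \<Longrightarrow> typM (D_Case d es) (\<Gamma> ++\<^sub>f \<Delta>) (Case M Ns) U"
| T_Sub: "\<lbrakk> typM d (\<Gamma> ,, x \<mapsto> T) M U; typM e \<Delta> N T;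
      x \<notin> keys \<Gamma>; x \<notin> keys \<Delta>; keys \<Gamma> \<inter> keys \<Delta> = {} \<rbrakk>
    \<Longrightarrow> typM (D_Sub d e x) (\<Gamma> ++\<^sub>f \<Delta>) (Sub M N x) U"
| T_Send': "\<lbrakk> typM d \<Gamma> M T; typM e \<Delta> N (TSess (SSend T S)); keys \<Gamma> \<inter> keys \<Delta> = {} \<rbrakk>
    \<Longrightarrow> typM (D_Send' d e) (\<Gamma> ++\<^sub>f \<Delta>) (Send' M N) (TSess S)"

datatype derB =
    D_Buf
  | D_BufSend derM derB
  | D_BufSelect label derB

text \<open>\<open>typB b \<Gamma> ms S' S\<close>: the tree b derives that, under \<open>\<Gamma>\<close>, the buffer ms has type S' > S.\<close>

inductive typB :: "derB \<Rightarrow> env \<Rightarrow> msg list \<Rightarrow> sty \<Rightarrow> sty \<Rightarrow> bool" where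
  T_Buf: "typB D_Buf fmempty [] S' S'"
| T_BufSend: "\<lbrakk> typM d \<Gamma> M T; typB b \<Delta> ms S' S; keys \<Gamma> \<inter> keys \<Delta> = {} \<rbrakk>
    \<Longrightarrow> typB (D_BufSend d b) (\<Gamma> ++\<^sub>f \<Delta>) (ms @ [MsgTerm M]) S' (SSend T S)"
| T_BufSelect: "\<lbrakk> typB b \<Gamma> ms S' S; fmlookup Ss j = Some S \<rbrakk>
    \<Longrightarrow> typB (D_BufSelect j b) \<Gamma> (ms @ [MsgLabel j]) S' (SPlus Ss)"

fun marker_add :: "marker \<Rightarrow> marker \<Rightarrow> marker option" where
  "marker_add Main_Thread Child_Thread = Some Main_Thread"
| "marker_add Child_Thread Main_Thread = Some Main_Thread"
| "marker_add Child_Thread Child_Thread = Some Child_Thread"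
| "marker_add Main_Thread Main_Thread = None"

datatype derC =
    D_Main derM
  | D_Child derM
  | D_ParL derC derC
  | D_ParR derC derC
  | D_Res name derB name derC
  | D_ResBuf name derB name derC
  | D_ConfSub derC derM name

inductive typC :: "derC \<Rightarrow> env \<Rightarrow> marker \<Rightarrow> conf \<Rightarrow> ty \<Rightarrow> bool" where
  T_Main: "typM d \<Gamma> M T \<Longrightarrow> typC (D_Main d) \<Gamma> Main_Thread (Thread Main_Thread M) T"
| T_Child: "typM d \<Gamma> M TUnit \<Longrightarrow> typC (D_Child d) \<Gamma> Child_Thread (Thread Child_Thread M) TUnit"
| T_ParL: "\<lbrakk> typC c \<Gamma> Child_Thread C TUnit; typC d \<Delta> \<phi> D T;
      marker_add Child_Thread \<phi> = Some \<phi>'; keys \<Gamma> \<inter> keys \<Delta> = {} \<rbrakk>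
    \<Longrightarrow> typC (D_ParL c d) (\<Gamma> ++\<^sub>f \<Delta>) \<phi>' (CPar C D) T"
| T_ParR: "\<lbrakk> typC c \<Gamma> \<phi> C T; typC d \<Delta> Child_Thread D TUnit;
      marker_add \<phi> Child_Thread = Some \<phi>'; keys \<Gamma> \<inter> keys \<Delta> = {} \<rbrakk>
    \<Longrightarrow> typC (D_ParR c d) (\<Gamma> ++\<^sub>f \<Delta>) \<phi>' (CPar C D) T"
| T_Res: "\<lbrakk> typB b \<Gamma> ms S' S; typC c (\<Delta> ,, x \<mapsto> TSess S' ,, y \<mapsto> TSess (sdual S)) \<phi> C T;
      x \<noteq> y; {x, y} \<inter> keys \<Gamma> = {}; {x, y} \<inter> keys \<Delta> = {}; keys \<Gamma> \<inter> keys \<Delta> = {} \<rbrakk>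
    \<Longrightarrow> typC (D_Res x b y c) (\<Gamma> ++\<^sub>f \<Delta>) \<phi> (CRes x ms y C) T"
| T_ResBuf: "\<lbrakk> typB b (\<Gamma> ,, y \<mapsto> TSess (sdual S)) ms S' S; typC c (\<Delta> ,, x \<mapsto> TSess S') \<phi> C T;
      x \<noteq> y; {x, y} \<inter> keys \<Gamma> = {}; {x, y} \<inter> keys \<Delta> = {}; keys \<Gamma> \<inter> keys \<Delta> = {} \<rbrakk>
    \<Longrightarrow> typC (D_ResBuf x b y c) (\<Gamma> ++\<^sub>f \<Delta>) \<phi> (CRes x ms y C) T"
| T_ConfSub: "\<lbrakk> typC c (\<Gamma> ,, x \<mapsto> T) \<phi> C U; typM d \<Delta> M T;
      x \<notin> keys \<Gamma>; x \<notin> keys \<Delta>; keys \<Gamma> \<inter> keys \<Delta> = {} \<rbrakk>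
    \<Longrightarrow> typC (D_ConfSub c d x) (\<Gamma> ++\<^sub>f \<Delta>) \<phi> (CSub C M x) U"

section \<open>APCP: processes and typing without priorities\<close>

datatype annot = Plain | Forwarder           \<comment> \<open>distinguishes the two forms of restriction\<close>

datatype proc =
    POut name name name                      \<comment> \<open>x[y,z]\<close>
  | PIn name name name proc                  \<comment> \<open>x(y,z).P, binding y and z\<close>
  | PSel name name label                     \<comment> \<open>\<open>PSel x z j\<close> is \<open>x[z] \<triangleleft> j\<close>\<close>
  | PBra name name "(label, proc) fmap"      \<comment> \<open>\<open>x(z) \<triangleright> {i : P\<^sub>i}\<close>, binding z\<close>
  | PRes annot name name proc
  | PPar proc proc  (infixr "\<parallel>" 65)
  | PNil
  | PFwd name name

abbreviation nu :: "name \<Rightarrow> name \<Rightarrow> proc \<Rightarrow> proc" where "nu \<equiv> PRes Plain"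
abbreviation nuF :: "name \<Rightarrow> name \<Rightarrow> proc \<Rightarrow> proc" where "nuF \<equiv> PRes Forwarder"

text \<open>All names occurring in a process, free or bound.\<close>

primrec namesP :: "proc \<Rightarrow> name set" where
  "namesP (POut x y z) = {x, y, z}"
| "namesP (PIn x y z P) = {x, y, z} \<union> namesP P"
| "namesP (PSel x z j) = {x, z}"
| "namesP (PBra x z Ps) = {x, z} \<union> \<Union> (fmran' (fmmap namesP Ps))"
| "namesP (PRes an x y P) = {x, y} \<union> namesP P"
| "namesP (P \<parallel> Q) = namesP P \<union> namesP Q"
| "namesP PNil = {}"
| "namesP (PFwd x y) = {x, y}"

text \<open>
  \<open>ren P d x\<close> is P{d/x}: the free occurrences of x become d. It does not rename binders; below it is
  only used for a d that does not occur in P at all, so that nothing is captured.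
\<close>

primrec ren :: "proc \<Rightarrow> name \<Rightarrow> name \<Rightarrow> proc" where
  "ren (POut u v w) d x =
     POut (if u = x then d else u) (if v = x then d else v) (if w = x then d else w)"
| "ren (PIn u v w P) d x =
     PIn (if u = x then d else u) v w (if x \<in> {v, w} then P else ren P d x)"
| "ren (PSel u w j) d x = PSel (if u = x then d else u) (if w = x then d else w) j"
| "ren (PBra u w Ps) d x =
     PBra (if u = x then d else u) w (if x = w then Ps else fmmap (\<lambda>P. ren P d x) Ps)"
| "ren (PRes an u v P) d x = PRes an u v (if x \<in> {u, v} then P else ren P d x)"
| "ren (P \<parallel> Q) d x = ren P d x \<parallel> ren Q d x"
| "ren PNil d x = PNil"
| "ren (PFwd u v) d x = PFwd (if u = x then d else u) (if v = x then d else v)"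

datatype aty =
    ATensor aty aty  (infixr "\<otimes>" 70)
  | APar aty aty  (infixr "\<wp>" 70)
  | APlus "(label, aty) fmap"
  | AWith "(label, aty) fmap"
  | ABullet  ("\<bullet>")

primrec adual :: "aty \<Rightarrow> aty" where
  "adual (A \<otimes> B) = adual A \<wp> adual B"
| "adual (A \<wp> B) = adual A \<otimes> adual B"
| "adual (APlus As) = AWith (fmmap adual As)"
| "adual (AWith As) = APlus (fmmap adual As)"
| "adual \<bullet> = \<bullet>"

type_synonym aenv = "(name, aty) fmap"

inductive ptyp :: "proc \<Rightarrow> aenv \<Rightarrow> bool"  (infix "\<turnstile>\<^sup>*" 50) where
  P_Nil: "PNil \<turnstile>\<^sup>* fmempty"
| P_Bullet: "\<lbrakk> P \<turnstile>\<^sup>* \<Gamma>; x \<notin> keys \<Gamma> \<rbrakk> \<Longrightarrow> P \<turnstile>\<^sup>* \<Gamma> ,, x \<mapsto> \<bullet>"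
| P_Fwd: "x \<noteq> y \<Longrightarrow> PFwd x y \<turnstile>\<^sup>* fmempty ,, x \<mapsto> adual A ,, y \<mapsto> A"
| P_Par: "\<lbrakk> P \<turnstile>\<^sup>* \<Gamma>; Q \<turnstile>\<^sup>* \<Delta>; keys \<Gamma> \<inter> keys \<Delta> = {} \<rbrakk> \<Longrightarrow> P \<parallel> Q \<turnstile>\<^sup>* \<Gamma> ++\<^sub>f \<Delta>"
| P_Res: "\<lbrakk> P \<turnstile>\<^sup>* \<Gamma> ,, x \<mapsto> A ,, y \<mapsto> adual A; x \<noteq> y; x \<notin> keys \<Gamma>; y \<notin> keys \<Gamma> \<rbrakk>
    \<Longrightarrow> PRes an x y P \<turnstile>\<^sup>* \<Gamma>"
| P_Out: "distinct [x, y, z]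
    \<Longrightarrow> POut x y z \<turnstile>\<^sup>* fmempty ,, x \<mapsto> A \<otimes> B ,, y \<mapsto> adual A ,, z \<mapsto> adual B"
| P_In: "\<lbrakk> P \<turnstile>\<^sup>* \<Gamma> ,, y \<mapsto> A ,, z \<mapsto> B; y \<noteq> z; y \<notin> keys \<Gamma>; z \<notin> keys \<Gamma>; x \<notin> keys \<Gamma> \<rbrakk>
    \<Longrightarrow> PIn x y z P \<turnstile>\<^sup>* \<Gamma> ,, x \<mapsto> A \<wp> B"
| P_Sel: "\<lbrakk> fmlookup As j = Some A; x \<noteq> z \<rbrakk>
    \<Longrightarrow> PSel x z j \<turnstile>\<^sup>* fmempty ,, x \<mapsto> APlus As ,, z \<mapsto> adual A"
| P_Bra: "\<lbrakk> keys Ps = keys As;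
      \<forall>i P A. fmlookup Ps i = Some P \<longrightarrow> fmlookup As i = Some A \<longrightarrow> P \<turnstile>\<^sup>* \<Gamma> ,, z \<mapsto> A;
      z \<notin> keys \<Gamma>; x \<notin> keys \<Gamma> \<rbrakk>
    \<Longrightarrow> PBra x z Ps \<turnstile>\<^sup>* \<Gamma> ,, x \<mapsto> AWith As"

section \<open>Translation of types\<close>

primrec trT :: "ty \<Rightarrow> aty" and trS :: "sty \<Rightarrow> aty" where
  "trT (TProd T U) = (trT T \<wp> \<bullet>) \<otimes> (trT U \<wp> \<bullet>)"
| "trT (TFun T U) = (adual (trT T) \<otimes> \<bullet>) \<wp> trT U"
| "trT TUnit = \<bullet>"
| "trT (TSess S) = trS S"
| "trS (SSend T S) = (adual (trT T) \<otimes> \<bullet>) \<wp> trS S"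
| "trS (SRecv T S) = (trT T \<wp> \<bullet>) \<otimes> trS S"
| "trS (SPlus Ss) = AWith (fmmap trS Ss)"
| "trS (SWith Ss) = APlus (fmmap trS Ss)"
| "trS SEnd = \<bullet>"

text \<open>The dual of the translation of an environment.\<close>

definition denv :: "env \<Rightarrow> aenv" where
  "denv \<Gamma> = fmmap (\<lambda>T. adual (trT T)) \<Gamma>"

section \<open>Translation of derivations\<close>

text \<open>
  Freshness of newly introduced names is made explicit: the translations take the set V of names
  that are in use, and at each node all new names are k, k+1, ... for a k above V and above the
  name z at which the term is translated.
\<close>

definition fresh :: "name set \<Rightarrow> name" where
  "fresh V = Suc (Max (insert 0 V))"

text \<open>
  The clauses for T-Var, T-App and T-Pair are given separately, as the clauses for T-New and T-Case
  translate the terms (x,y) and \<open>N\<^sub>i\<close> c, whose derivations are not subderivations. The arguments P, Q are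
  the translations of the premises, as functions of V and z.
\<close>

type_synonym trans = "name set \<Rightarrow> name \<Rightarrow> proc"

definition tr_Var :: "name \<Rightarrow> trans" where
  "tr_Var x V z = PFwd x z"

definition tr_App :: "trans \<Rightarrow> trans \<Rightarrow> trans" where
  "tr_App P Q V z =
    (let k = fresh (insert z V); W = insert z V \<union> {k..<k+6};
         a = k; b = k+1; c = k+2; d = k+3; e = k+4; f = k+5
     in nu a b (P W a \<parallel> nu c d (POut b c z \<parallel> PIn d e f (Q W e))))"

definition tr_Pair :: "trans \<Rightarrow> trans \<Rightarrow> trans" where
  "tr_Pair P Q V z =
    (let k = fresh (insert z V); W = insert z V \<union> {k..<k+8};
         a = k; b = k+1; c = k+2; d = k+3; e = k+4; f = k+5; g = k+6; h = k+7
     in nu a b (nu c d (POut z a c \<parallel> PIn b e f (P W e) \<parallel> PIn d g h (Q W g))))"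

primrec trM :: "derM \<Rightarrow> name set \<Rightarrow> name \<Rightarrow> proc" where
  "trM (D_Var x) V z = tr_Var x V z"
| "trM D_Unit V z = PNil"
| "trM (D_Abs x dM) V z =
    (let k = fresh (insert z V); W = insert z V \<union> {k..<k+5};
         a = k; b = k+1; c = k+2; e = k+3; f = k+4
     in PIn z a b (nuF c x (nu e f (POut a c e) \<parallel> trM dM W b)))"
| "trM (D_App dM dN) V z = tr_App (trM dM) (trM dN) V z"
| "trM (D_Pair dM dN) V z = tr_Pair (trM dM) (trM dN) V z"
| "trM (D_Split x y dM dN) V z =
    (let k = fresh (insert z V); W = insert z V \<union> {k..<k+10};
         a = k; b = k+1; c = k+2; d = k+3; e = k+4; f = k+5; g = k+6; h = k+7; kk = k+8; l = k+9
     in nu a b (trM dM W a \<parallel>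
          PIn b c d (nuF e x (nuF f y
            (nu g h (POut c e g) \<parallel> nu kk l (POut d f kk) \<parallel> trM dN W z)))))"
| "trM D_New V z =
    (let k = fresh (insert z V); W = insert z V \<union> {k..<k+8};
         a = k; b = k+1; c = k+2; d = k+3; e = k+4; f = k+5; x = k+6; y = k+7
     in nu a b (nu c d (POut a c d) \<parallel>
          PIn b e f (nu x y (tr_Pair (tr_Var x) (tr_Var y) W z))))"
| "trM (D_Spawn dM) V z =
    (let k = fresh (insert z V); W = insert z V \<union> {k..<k+8};
         a = k; b = k+1; c = k+2; d = k+3; e = k+4; f = k+5; g = k+6; h = k+7
     in nu a b (trM dM W a \<parallel>
          PIn b c d (nu e f (POut c e f) \<parallel> nu g h (POut d z g))))"
| "trM (D_EndL x dM) V z = trM dM V z"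
| "trM (D_EndR x) V z = PNil"
| "trM (D_Send dM) V z =
    (let k = fresh (insert z V); W = insert z V \<union> {k..<k+10};
         a = k; b = k+1; c = k+2; d = k+3; e = k+4; f = k+5; g = k+6; h = k+7; kk = k+8; l = k+9
     in nu a b (trM dM W a \<parallel>
          PIn b c d (nu e f (nu g h (POut d e g) \<parallel> nu kk l (POut f c kk \<parallel> PFwd l z)))))"
| "trM (D_Recv dM) V z =
    (let k = fresh (insert z V); W = insert z V \<union> {k..<k+8};
         a = k; b = k+1; c = k+2; d = k+3; e = k+4; f = k+5; g = k+6; h = k+7
     in nu a b (trM dM W a \<parallel>
          PIn b c d (nu e f (POut z c e \<parallel> PIn f g h (PFwd d g)))))"
| "trM (D_Select j dM) V z =
    (let k = fresh (insert z V); W = insert z V \<union> {k..<k+4};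
         a = k; b = k+1; c = k+2; d = k+3
     in nu a b (trM dM W a \<parallel> nu c d (PSel b c j \<parallel> PFwd d z)))"
| "trM (D_Case dM dNs) V z =
    (let k = fresh (insert z V); W = insert z V \<union> {k..<k+3};
         a = k; b = k+1; c = k+2
     in nu a b (trM dM W a \<parallel>
          PBra b c (fmmap (\<lambda>dN. tr_App (trM dN) (tr_Var c) W z) dNs)))"
| "trM (D_Sub dM dN x) V z =
    (let k = fresh (insert z V); W = insert z V \<union> {k..<k+1};
         a = k
     in nuF x a (trM dM W z \<parallel> trM dN W a))"
| "trM (D_Send' dM dN) V z =
    (let k = fresh (insert z V); W = insert z V \<union> {k..<k+8};
         a = k; b = k+1; c = k+2; d = k+3; e = k+4; f = k+5; g = k+6; h = k+7
     in nu a b (PIn a c d (trM dM W c) \<parallel>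
          nu e f (trM dN W e \<parallel> nu g h (POut f b g \<parallel> PFwd h z))))"

text \<open>\<open>trB b V x P\<close>: here the new names also avoid all names of the continuation process P.\<close>

primrec trB :: "derB \<Rightarrow> name set \<Rightarrow> name \<Rightarrow> proc \<Rightarrow> proc" where
  "trB D_Buf V x P = P"
| "trB (D_BufSend dM dB) V x P =
    (let k = fresh (insert x V \<union> namesP P); W = insert x V \<union> {k..<k+8};
         a = k; b = k+1; c = k+2; d = k+3; e = k+4; f = k+5; g = k+6; h = k+7
     in nu a b (nu c d
          (nu g h (PFwd x g \<parallel> POut h a c) \<parallel> PIn b e f (trM dM W e) \<parallel> trB dB W d (ren P d x))))"
| "trB (D_BufSelect j dB) V x P =
    (let k = fresh (insert x V \<union> namesP P); W = insert x V \<union> {k..<k+4};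
         a = k; b = k+1; c = k+2; d = k+3
     in nu a b (nu c d (PFwd x c \<parallel> PSel d a j) \<parallel> trB dB W b (ren P b x)))"

primrec trC :: "derC \<Rightarrow> name set \<Rightarrow> name \<Rightarrow> proc" where
  "trC (D_Main dM) V z = trM dM V z"
| "trC (D_Child dM) V z = trM dM V z"
| "trC (D_ParL dC dD) V z =
    (let k = fresh (insert z V); W = insert z V \<union> {k..<k+2};
         a = k; b = k+1
     in nu a b (trC dC W a) \<parallel> trC dD W z)"
| "trC (D_ParR dC dD) V z =
    (let k = fresh (insert z V); W = insert z V \<union> {k..<k+2};
         a = k; b = k+1
     in trC dC W z \<parallel> nu a b (trC dD W a))"
| "trC (D_Res x dB y dC) V z = nu x y (trB dB (insert z V) x (trC dC V z))"
| "trC (D_ResBuf x dB y dC) V z = nu x y (trB dB (insert z V) x (trC dC V z))"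
| "trC (D_ConfSub dC dM x) V z =
    (let k = fresh (insert z V); W = insert z V \<union> {k..<k+1};
         a = k
     in nuF x a (trC dC W z \<parallel> trM dM W a))"

end

theory Submission
  imports Defs
begin

text \<open>
  Most restrictions introduced by the translation are cuts between two typed processes, or bind an
  unused name of type \<open>\<bullet>\<close>. Hence each clause is an admissible rule of the process type system, with
  the translated subderivations abstracted to arbitrary typed processes, and the theorem follows by
  induction on derivations. Buffers also need typing to be preserved when the endpoint of the
  continuation is renamed to a fresh name.
\<close>

section \<open>Duality and contexts\<close>

text \<open>Terms are raw and contexts are finite maps, so the obstacle is keeping names apart. The
  recursion adds the new names to the set of used names before it enters a subderivation, so the
  name at which that subderivation is translated may already be in the set it receives. The
  invariant is therefore asymmetric: \<open>V\<close> contains all free and bound variables of the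
  term, but \<open>z\<close> has to avoid only those variables, not \<open>V\<close>. Bound
  variables count because the translation keeps them as names of the process: under a binder they
  stand in the context next to \<open>z\<close>.

  Not every restriction is a cut. Where both endpoints end up on the same side of a parallel
  composition (pairs, splits, buffered restrictions), the components are first typed together and
  the restriction is closed afterwards. Contexts are kept explicit throughout, since weakening with
  \<open>\<bullet>\<close> prevents them from being read off the process.\<close>

lemma adual_adual [simp]: "adual (adual A) = A"
  by (induction A) (auto intro!: fmap_ext simp: fmran'I map_option_case split: option.splits)

lemma fmmap_adual_adual [simp]: "fmmap adual (fmmap adual As) = As"
  by (auto intro!: fmap_ext simp: map_option_case split: option.splits)

text \<open>The translation turns outputs into inputs, but it does so uniformly, so it still
  commutes with duality. \<open>sdual\<close> leaves payload types alone; hence the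
  \<open>ty\<close> half of the mutual induction can be trivial, and the payloads agree because
  \<open>adual\<close> is an involution.\<close>

lemma trS_sdual [simp]: "trS (sdual S) = adual (trS S)"
  by (induction S rule: sty.induct[where ?P1.0 = "\<lambda>_. True"])
    (auto intro!: fmap_ext simp: fmran'I map_option_case split: option.splits)

text \<open>\<open>fmadd\<close> prefers its right argument, so an update of the left one can be
  pulled out only if \<Delta> does not override it.\<close>

lemma fmadd_fmupd_left:
  "x \<notin> keys \<Delta> \<Longrightarrow> (\<Gamma> ,, x \<mapsto> A) ++\<^sub>f \<Delta> = \<Gamma> ++\<^sub>f \<Delta> ,, x \<mapsto> A"
  by (auto intro!: fmap_ext simp: fmlookup_dom_iff fmlookup_dom'_iff)

text \<open>Reordering is a permutative rewrite rule: the simplifier sorts chains of updates, and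
  two presentations of one context meet in a normal form once their names are known to
  differ.\<close>

lemmas ctx_simps = fmadd_fmupd_left fmupd_reorder_neq

section \<open>Admissible rules of the process type system\<close>

lemma ptyp_cong: "P \<turnstile>\<^sup>* \<Gamma> \<Longrightarrow> \<Gamma> = \<Delta> \<Longrightarrow> P \<turnstile>\<^sup>* \<Delta>"
  by simp

lemma ptyp_res:
  "\<lbrakk>P \<turnstile>\<^sup>* \<Theta>; \<Theta> = \<Gamma> ,, a \<mapsto> A ,, b \<mapsto> adual A; a \<noteq> b; {a, b} \<inter> keys \<Gamma> = {}\<rbrakk>
    \<Longrightarrow> PRes an a b P \<turnstile>\<^sup>* \<Gamma>"
  by (simp add: P_Res)

text \<open>The duals are moved to the subject, so that the names sent carry the types against which
  their partners are cut.\<close>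

lemma ptyp_out:
  "distinct [x, y, z] \<Longrightarrow>
    POut x y z \<turnstile>\<^sup>* fmempty ,, x \<mapsto> adual A \<otimes> adual B ,, y \<mapsto> A ,, z \<mapsto> B"
  using P_Out[where A = "adual A" and B = "adual B"] by simp

lemma ptyp_fwd: "x \<noteq> y \<Longrightarrow> PFwd x y \<turnstile>\<^sup>* fmempty ,, x \<mapsto> A ,, y \<mapsto> adual A"
  using P_Fwd[of x y "adual A"] by simp

text \<open>The resulting context and the duality of the two types are premises in equational form.
  Resolution then needs no syntactic match, and the simplifier settles reorderings and double
  duals.\<close>

lemma ptyp_cut:
  assumes "P \<turnstile>\<^sup>* \<Gamma> ,, a \<mapsto> A" "Q \<turnstile>\<^sup>* \<Delta> ,, b \<mapsto> B" "\<Gamma> ++\<^sub>f \<Delta> = \<Theta>" "B = adual A"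
    and "a \<noteq> b" "{a, b} \<inter> (keys \<Gamma> \<union> keys \<Delta>) = {}" "keys \<Gamma> \<inter> keys \<Delta> = {}"
  shows "PRes an a b (P \<parallel> Q) \<turnstile>\<^sup>* \<Theta>"
  by (rule ptyp_res[OF P_Par[OF assms(1,2)], where A = A])
    (use assms(3-) in \<open>auto simp: ctx_simps\<close>)

text \<open>Weakening supplies the missing endpoint \<open>b\<close>, and \<bullet> is
  self-dual.\<close>

lemma ptyp_res_bullet:
  assumes "P \<turnstile>\<^sup>* \<Gamma> ,, a \<mapsto> \<bullet>" "a \<noteq> b" "{a, b} \<inter> keys \<Gamma> = {}"
  shows "PRes an a b P \<turnstile>\<^sup>* \<Gamma>"
  by (rule ptyp_res[OF P_Bullet[OF assms(1), of b], where A = \<bullet>]) (use assms(2,3) in auto)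

lemma ptyp_out_bullet:
  assumes "distinct [x, y, g, h]"
  shows "nu g h (POut x y g) \<turnstile>\<^sup>* fmempty ,, x \<mapsto> adual A \<otimes> \<bullet> ,, y \<mapsto> A"
  using assms ptyp_out[where A = A and B = \<bullet>] by (intro ptyp_res_bullet) auto

text \<open>Here the two names sent are connected to each other, which is possible because both have
  the self-dual type \<bullet>.\<close>

lemma ptyp_out_bullets:
  assumes "distinct [x, y, z]"
  shows "nu y z (POut x y z) \<turnstile>\<^sup>* fmempty ,, x \<mapsto> \<bullet> \<otimes> \<bullet>"
  using assms ptyp_out[of x y z \<bullet> \<bullet>] by (intro P_Res[where A=\<bullet>]) auto

lemma ptyp_in_bullet:
  assumes "P \<turnstile>\<^sup>* \<Gamma> ,, y \<mapsto> A" "y \<noteq> z" "{x, y, z} \<inter> keys \<Gamma> = {}"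
  shows "PIn x y z P \<turnstile>\<^sup>* \<Gamma> ,, x \<mapsto> A \<wp> \<bullet>"
  using P_Bullet[OF assms(1), of z] assms(2,3) by (intro P_In) auto

section \<open>Clauses of the term translation as derived rules\<close>

lemma ptyp_abs:
  assumes P: "P \<turnstile>\<^sup>* \<Gamma> ,, x \<mapsto> adual A ,, b \<mapsto> B"
    and "distinct [z, a, b, c, e, f, x]" "{z, a, b, c, e, f, x} \<inter> keys \<Gamma> = {}"
  shows "PIn z a b (nuF c x (nu e f (POut a c e) \<parallel> P)) \<turnstile>\<^sup>* \<Gamma> ,, z \<mapsto> (adual A \<otimes> \<bullet>) \<wp> B"
proof -
  \<comment> \<open>A cut acts on the outermost entry, whereas the translated body comes with its
    result name \<open>b\<close> outermost.\<close>
  have P': "P \<turnstile>\<^sup>* \<Gamma> ,, b \<mapsto> B ,, x \<mapsto> adual A"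
    by (rule ptyp_cong[OF P]) (use assms(2-) in \<open>(clarsimp simp: ctx_simps)+\<close>)
  have "nuF c x (nu e f (POut a c e) \<parallel> P) \<turnstile>\<^sup>* \<Gamma> ,, a \<mapsto> adual A \<otimes> \<bullet> ,, b \<mapsto> B"
    by (rule ptyp_cut[OF ptyp_out_bullet[where A = A] P'])
      (use assms(2-) in \<open>(clarsimp simp: ctx_simps)+\<close>)
  then show ?thesis
    by (rule P_In) (use assms(2-) in \<open>(clarsimp simp: ctx_simps)+\<close>)
qed

text \<open>The argument waits behind the input on \<open>d\<close> until the function asks for it
  through \<open>c\<close>. The name \<open>z\<close> itself is sent as the continuation of the
  call, so the result of type \<open>B\<close> arrives there directly.\<close>

lemma ptyp_app:
  assumes P: "P \<turnstile>\<^sup>* \<Gamma> ,, a \<mapsto> (adual A \<otimes> \<bullet>) \<wp> B" and Q: "Q \<turnstile>\<^sup>* \<Delta> ,, e \<mapsto> A"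
    and "distinct [a, b, c, d, e, f, z]"
    and "{a, b, c, d, e, f, z} \<inter> (keys \<Gamma> \<union> keys \<Delta>) = {}" "keys \<Gamma> \<inter> keys \<Delta> = {}"
  shows "nu a b (P \<parallel> nu c d (POut b c z \<parallel> PIn d e f Q)) \<turnstile>\<^sup>* \<Gamma> ++\<^sub>f \<Delta> ,, z \<mapsto> B"
proof -
  have Q': "PIn d e f Q \<turnstile>\<^sup>* \<Delta> ,, d \<mapsto> A \<wp> \<bullet>"
    using Q by (rule ptyp_in_bullet) (use assms(3-) in auto)
  have O: "POut b c z \<turnstile>\<^sup>* fmempty ,, b \<mapsto> (A \<wp> \<bullet>) \<otimes> adual B ,, z \<mapsto> B ,, c \<mapsto> adual A \<otimes> \<bullet>"
    by (rule ptyp_cong[OF ptyp_out[where A = "adual A \<otimes> \<bullet>" and B = B]])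
      (use assms(3-) in \<open>(clarsimp simp: ctx_simps)+\<close>)
  have R: "nu c d (POut b c z \<parallel> PIn d e f Q) \<turnstile>\<^sup>* \<Delta> ,, z \<mapsto> B ,, b \<mapsto> (A \<wp> \<bullet>) \<otimes> adual B"
    by (rule ptyp_cut[OF O Q']) (use assms(3-) in \<open>(clarsimp simp: ctx_simps)+\<close>)
  show ?thesis
    by (rule ptyp_cut[OF P R]) (use assms(3-) in \<open>(clarsimp simp: ctx_simps)+\<close>)
qed

text \<open>A single output uses both \<open>a\<close> and \<open>c\<close>. Only the inner
  restriction is a cut; after it \<open>a\<close> and \<open>b\<close> belong to one and the same
  process, and \<open>P_Res\<close> closes them.\<close>

lemma ptyp_pair:
  assumes P: "P \<turnstile>\<^sup>* \<Gamma> ,, e \<mapsto> A" and Q: "Q \<turnstile>\<^sup>* \<Delta> ,, g \<mapsto> B"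
    and "distinct [a, b, c, d, e, f, g, h, z]"
    and "{a, b, c, d, e, f, g, h, z} \<inter> (keys \<Gamma> \<union> keys \<Delta>) = {}" "keys \<Gamma> \<inter> keys \<Delta> = {}"
  shows "nu a b (nu c d (POut z a c \<parallel> PIn b e f P \<parallel> PIn d g h Q))
    \<turnstile>\<^sup>* \<Gamma> ++\<^sub>f \<Delta> ,, z \<mapsto> (A \<wp> \<bullet>) \<otimes> (B \<wp> \<bullet>)"
proof -
  have P': "PIn b e f P \<turnstile>\<^sup>* \<Gamma> ,, b \<mapsto> A \<wp> \<bullet>"
    using P by (rule ptyp_in_bullet) (use assms(3-) in auto)
  have Q': "PIn d g h Q \<turnstile>\<^sup>* \<Delta> ,, d \<mapsto> B \<wp> \<bullet>"
    using Q by (rule ptyp_in_bullet) (use assms(3-) in auto)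
  have PQ: "PIn b e f P \<parallel> PIn d g h Q \<turnstile>\<^sup>* \<Gamma> ++\<^sub>f \<Delta> ,, b \<mapsto> A \<wp> \<bullet> ,, d \<mapsto> B \<wp> \<bullet>"
    by (rule ptyp_cong[OF P_Par[OF P' Q']])
      (use assms(3-) in \<open>(clarsimp simp: ctx_simps)+\<close>)
  have "nu c d (POut z a c \<parallel> PIn b e f P \<parallel> PIn d g h Q)
      \<turnstile>\<^sup>* \<Gamma> ++\<^sub>f \<Delta> ,, z \<mapsto> (A \<wp> \<bullet>) \<otimes> (B \<wp> \<bullet>) ,, a \<mapsto> adual A \<otimes> \<bullet> ,, b \<mapsto> adual (adual A \<otimes> \<bullet>)"
    by (rule ptyp_cut[OF ptyp_out[where A = "adual A \<otimes> \<bullet>" and B = "adual B \<otimes> \<bullet>"] PQ])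
      (use assms(3-) in \<open>(clarsimp simp: ctx_simps)+\<close>)
  then show ?thesis
    by (rule P_Res) (use assms(3-) in \<open>(clarsimp simp: ctx_simps)+\<close>)
qed

text \<open>The outputs on \<open>c\<close> and \<open>d\<close> request the two components of the
  pair. Both forwarder restrictions enclose these requests and \<open>Q\<close> together, so
  everything is composed before either is closed. Their scope ends inside the input on
  \<open>b\<close>; hence \<open>x\<close> and \<open>y\<close> have to avoid \<Delta> but may occur
  in \<Gamma>.\<close>

lemma ptyp_split:
  assumes P: "P \<turnstile>\<^sup>* \<Gamma> ,, a \<mapsto> (A \<wp> \<bullet>) \<otimes> (B \<wp> \<bullet>)"
    and Q: "Q \<turnstile>\<^sup>* \<Delta> ,, x \<mapsto> adual A ,, y \<mapsto> adual B ,, z \<mapsto> C"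
    and "distinct [a, b, c, d, e, f, g, h, k, l, x, y, z]"
    and "{a, b, c, d, e, f, g, h, k, l, z} \<inter> (keys \<Gamma> \<union> keys \<Delta>) = {}" "{x, y} \<inter> keys \<Delta> = {}"
    and "keys \<Gamma> \<inter> keys \<Delta> = {}"
  shows "nu a b (P \<parallel> PIn b c d (nuF e x (nuF f y
      (nu g h (POut c e g) \<parallel> nu k l (POut d f k) \<parallel> Q)))) \<turnstile>\<^sup>* \<Gamma> ++\<^sub>f \<Delta> ,, z \<mapsto> C"
proof -
  let ?Q1 = "nu k l (POut d f k) \<parallel> Q" and ?\<Delta>1 = "\<Delta> ,, z \<mapsto> C ,, d \<mapsto> adual B \<otimes> \<bullet>"
  let ?Q2 = "nu g h (POut c e g) \<parallel> ?Q1"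
  let ?\<Delta>2 = "\<Delta> ,, z \<mapsto> C ,, c \<mapsto> adual A \<otimes> \<bullet> ,, d \<mapsto> adual B \<otimes> \<bullet>"
  have Q1: "?Q1 \<turnstile>\<^sup>* ?\<Delta>1 ,, x \<mapsto> adual A ,, f \<mapsto> B ,, y \<mapsto> adual B"
    by (rule ptyp_cong[OF P_Par[OF ptyp_out_bullet[where A = B] Q]])
      (use assms(3-) in \<open>(clarsimp simp: ctx_simps)+\<close>)
  have "?Q2 \<turnstile>\<^sup>* ?\<Delta>2 ,, e \<mapsto> A ,, x \<mapsto> adual A ,, f \<mapsto> B ,, y \<mapsto> adual B"
    by (rule ptyp_cong[OF P_Par[OF ptyp_out_bullet[where A = A] Q1]])
      (use assms(3-) in \<open>(clarsimp simp: ctx_simps)+\<close>)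
  then have "nuF f y ?Q2 \<turnstile>\<^sup>* ?\<Delta>2 ,, e \<mapsto> A ,, x \<mapsto> adual A"
    by (rule P_Res) (use assms(3-) in \<open>(clarsimp simp: ctx_simps)+\<close>)
  then have "nuF e x (nuF f y ?Q2) \<turnstile>\<^sup>* ?\<Delta>2"
    by (rule P_Res) (use assms(3-) in \<open>(clarsimp simp: ctx_simps)+\<close>)
  then have R: "PIn b c d (nuF e x (nuF f y ?Q2))
      \<turnstile>\<^sup>* \<Delta> ,, z \<mapsto> C ,, b \<mapsto> (adual A \<otimes> \<bullet>) \<wp> (adual B \<otimes> \<bullet>)"
    by (rule P_In) (use assms(3-) in \<open>(clarsimp simp: ctx_simps)+\<close>)
  show ?thesis
    by (rule ptyp_cut[OF P R]) (use assms(3-) in \<open>(clarsimp simp: ctx_simps)+\<close>)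
qed

text \<open>The communication between \<open>a\<close> and \<open>b\<close> carries no data, as its
  types \<open>\<bullet> \<otimes> \<bullet>\<close> and \<open>\<bullet> \<wp> \<bullet>\<close>
  show; it only guards \<open>P\<close>.\<close>

lemma ptyp_new:
  assumes "distinct [a, b, c, d, e, f]" and P: "P \<turnstile>\<^sup>* \<Gamma>" "{a, b, e, f} \<inter> keys \<Gamma> = {}"
  shows "nu a b (nu c d (POut a c d) \<parallel> PIn b e f P) \<turnstile>\<^sup>* \<Gamma>"
proof -
  have "P \<turnstile>\<^sup>* \<Gamma> ,, e \<mapsto> \<bullet>"
    using assms by (auto intro!: P_Bullet)
  then have P': "PIn b e f P \<turnstile>\<^sup>* \<Gamma> ,, b \<mapsto> \<bullet> \<wp> \<bullet>"
    by (rule ptyp_in_bullet) (use assms in auto)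
  show ?thesis
    by (rule ptyp_cut[OF ptyp_out_bullets P']) (use assms in auto)
qed

text \<open>The first component has unit type and is triggered by an output of two names connected
  to each other. The second one is asked to deliver its result at \<open>z\<close>, which is sent
  along \<open>d\<close>.\<close>

lemma ptyp_spawn:
  assumes P: "P \<turnstile>\<^sup>* \<Gamma> ,, a \<mapsto> (\<bullet> \<wp> \<bullet>) \<otimes> (A \<wp> \<bullet>)"
    and "distinct [a, b, c, d, e, f, g, h, z]" "{a, b, c, d, e, f, g, h, z} \<inter> keys \<Gamma> = {}"
  shows "nu a b (P \<parallel> PIn b c d (nu e f (POut c e f) \<parallel> nu g h (POut d z g))) \<turnstile>\<^sup>* \<Gamma> ,, z \<mapsto> A"
proof -
  have "nu e f (POut c e f) \<parallel> nu g h (POut d z g)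
      \<turnstile>\<^sup>* fmempty ,, z \<mapsto> A ,, c \<mapsto> \<bullet> \<otimes> \<bullet> ,, d \<mapsto> adual A \<otimes> \<bullet>"
    by (rule ptyp_cong[OF P_Par[OF ptyp_out_bullets ptyp_out_bullet[where A = A]]])
      (use assms(2-) in \<open>(clarsimp simp: ctx_simps)+\<close>)
  then have Q: "PIn b c d (nu e f (POut c e f) \<parallel> nu g h (POut d z g))
      \<turnstile>\<^sup>* fmempty ,, z \<mapsto> A ,, b \<mapsto> (\<bullet> \<otimes> \<bullet>) \<wp> (adual A \<otimes> \<bullet>)"
    by (rule P_In) (use assms(2-) in \<open>(clarsimp simp: ctx_simps)+\<close>)
  show ?thesis
    by (rule ptyp_cut[OF P Q]) (use assms(2-) in \<open>(clarsimp simp: ctx_simps)+\<close>)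
qed

text \<open>The common tail of the clauses for \<open>D_Send\<close> and \<open>D_Send'\<close>: the
  forwarder hands the continuation of the output on to \<open>z\<close>.\<close>

lemma ptyp_out_fwd:
  assumes "distinct [x, y, g, h, z]"
  shows "nu g h (POut x y g \<parallel> PFwd h z) \<turnstile>\<^sup>* fmempty ,, y \<mapsto> A ,, z \<mapsto> B ,, x \<mapsto> adual A \<otimes> adual B"
  by (rule ptyp_cut[OF ptyp_out[where A = A and B = B] ptyp_cong[OF ptyp_fwd[where A = "adual B"] fmupd_reorder_neq]])
    (use assms in \<open>(clarsimp simp: ctx_simps)+\<close>)

text \<open>The payload is passed on without being requested: the name \<open>c\<close> received for
  it has type \<open>adual A \<otimes> \<bullet>\<close>, which is exactly what the output on
  \<open>f\<close> needs as its first object. Only the channel component is requested, through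
  \<open>d\<close>.\<close>

lemma ptyp_send:
  assumes P: "P \<turnstile>\<^sup>* \<Gamma> ,, a \<mapsto> (A \<wp> \<bullet>) \<otimes> (((adual A \<otimes> \<bullet>) \<wp> B) \<wp> \<bullet>)"
    and "distinct [a, b, c, d, e, f, g, h, k, l, z]" "{a, b, c, d, e, f, g, h, k, l, z} \<inter> keys \<Gamma> = {}"
  shows "nu a b (P \<parallel> PIn b c d (nu e f (nu g h (POut d e g)
      \<parallel> nu k l (POut f c k \<parallel> PFwd l z)))) \<turnstile>\<^sup>* \<Gamma> ,, z \<mapsto> B"
proof -
  let ?S = "(adual A \<otimes> \<bullet>) \<wp> B"
  let ?Q = "nu k l (POut f c k \<parallel> PFwd l z)"
  have Q: "?Q \<turnstile>\<^sup>* fmempty ,, c \<mapsto> adual A \<otimes> \<bullet> ,, z \<mapsto> B ,, f \<mapsto> adual ?S"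
    by (rule ptyp_cong[OF ptyp_out_fwd[where A = "adual A \<otimes> \<bullet>" and B = B]])
      (use assms(2-) in \<open>(clarsimp simp: ctx_simps)+\<close>)
  have "nu e f (nu g h (POut d e g) \<parallel> ?Q) \<turnstile>\<^sup>*
      fmempty ,, z \<mapsto> B ,, c \<mapsto> adual A \<otimes> \<bullet> ,, d \<mapsto> adual ?S \<otimes> \<bullet>"
    by (rule ptyp_cut[OF ptyp_out_bullet[where A = ?S] Q])
      (use assms(2-) in \<open>(clarsimp simp: ctx_simps)+\<close>)
  then have R: "PIn b c d (nu e f (nu g h (POut d e g) \<parallel> ?Q)) \<turnstile>\<^sup>* fmempty ,, z \<mapsto> B
      ,, b \<mapsto> (adual A \<otimes> \<bullet>) \<wp> (adual ?S \<otimes> \<bullet>)"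
    by (rule P_In) (use assms(2-) in \<open>(clarsimp simp: ctx_simps)+\<close>)
  show ?thesis
    by (rule ptyp_cut[OF P R]) (use assms(2-) in \<open>(clarsimp simp: ctx_simps)+\<close>)
qed

text \<open>The received type and the resulting pair type differ only in the guard
  \<open>B \<wp> \<bullet>\<close> of the second component. The input on \<open>f\<close> provides
  this guard, while \<open>c\<close> is sent on as it is.\<close>

lemma ptyp_recv:
  assumes P: "P \<turnstile>\<^sup>* \<Gamma> ,, a \<mapsto> (A \<wp> \<bullet>) \<otimes> B"
    and "distinct [a, b, c, d, e, f, g, h, z]" "{a, b, c, d, e, f, g, h, z} \<inter> keys \<Gamma> = {}"
  shows "nu a b (P \<parallel> PIn b c d (nu e f (POut z c e \<parallel> PIn f g h (PFwd d g))))
    \<turnstile>\<^sup>* \<Gamma> ,, z \<mapsto> (A \<wp> \<bullet>) \<otimes> (B \<wp> \<bullet>)"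
proof -
  have Q: "PIn f g h (PFwd d g) \<turnstile>\<^sup>* fmempty ,, d \<mapsto> adual B ,, f \<mapsto> B \<wp> \<bullet>"
    using assms(2) ptyp_fwd[of d g "adual B"] by (intro ptyp_in_bullet) auto
  have "nu e f (POut z c e \<parallel> PIn f g h (PFwd d g)) \<turnstile>\<^sup>*
      fmempty ,, z \<mapsto> (A \<wp> \<bullet>) \<otimes> (B \<wp> \<bullet>) ,, c \<mapsto> adual A \<otimes> \<bullet> ,, d \<mapsto> adual B"
    by (rule ptyp_cut[OF ptyp_out[where A = "adual A \<otimes> \<bullet>" and B = "adual B \<otimes> \<bullet>"] Q])
      (use assms(2-) in \<open>(clarsimp simp: ctx_simps)+\<close>)
  then have R: "PIn b c d (nu e f (POut z c e \<parallel> PIn f g h (PFwd d g))) \<turnstile>\<^sup>*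
      fmempty ,, z \<mapsto> (A \<wp> \<bullet>) \<otimes> (B \<wp> \<bullet>) ,, b \<mapsto> (adual A \<otimes> \<bullet>) \<wp> adual B"
    by (rule P_In) (use assms(2-) in \<open>(clarsimp simp: ctx_simps)+\<close>)
  show ?thesis
    by (rule ptyp_cut[OF P R]) (use assms(2-) in \<open>(clarsimp simp: ctx_simps)+\<close>)
qed

lemma ptyp_select:
  assumes P: "P \<turnstile>\<^sup>* \<Gamma> ,, a \<mapsto> AWith As" and "fmlookup As j = Some A"
    and "distinct [a, b, c, d, z]" "{a, b, c, d, z} \<inter> keys \<Gamma> = {}"
  shows "nu a b (P \<parallel> nu c d (PSel b c j \<parallel> PFwd d z)) \<turnstile>\<^sup>* \<Gamma> ,, z \<mapsto> A"
proof -
  \<comment> \<open>\<open>P_Sel\<close> dualizes the selected branch, so it is instantiated with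
    the dual family; the second dual cancels at \<open>c\<close>.\<close>
  have S: "PSel b c j \<turnstile>\<^sup>* fmempty ,, b \<mapsto> adual (AWith As) ,, c \<mapsto> A"
    using assms(2,3) P_Sel[of "fmmap adual As" j "adual A" b c] by simp
  have F: "PFwd d z \<turnstile>\<^sup>* fmempty ,, z \<mapsto> A ,, d \<mapsto> adual A"
    by (rule ptyp_cong[OF ptyp_fwd[where A = "adual A"]])
      (use assms(3-) in \<open>(clarsimp simp: ctx_simps)+\<close>)
  have R: "nu c d (PSel b c j \<parallel> PFwd d z) \<turnstile>\<^sup>* fmempty ,, z \<mapsto> A ,, b \<mapsto> adual (AWith As)"
    by (rule ptyp_cut[OF S F]) (use assms(3-) in \<open>(clarsimp simp: ctx_simps)+\<close>)
  show ?thesis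
    by (rule ptyp_cut[OF P R]) (use assms(3-) in \<open>(clarsimp simp: ctx_simps)+\<close>)
qed

lemma ptyp_case:
  assumes P: "P \<turnstile>\<^sup>* \<Gamma> ,, a \<mapsto> APlus As" and "keys Ps = keys As"
    and Q: "\<And>i Q A. fmlookup Ps i = Some Q \<Longrightarrow> fmlookup As i = Some A
      \<Longrightarrow> Q \<turnstile>\<^sup>* \<Delta> ,, c \<mapsto> adual A ,, z \<mapsto> B"
    and "distinct [a, b, c, z]" "{a, b, c, z} \<inter> (keys \<Gamma> \<union> keys \<Delta>) = {}" "keys \<Gamma> \<inter> keys \<Delta> = {}"
  shows "nu a b (P \<parallel> PBra b c Ps) \<turnstile>\<^sup>* \<Gamma> ++\<^sub>f \<Delta> ,, z \<mapsto> B"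
proof -
  have "Q \<turnstile>\<^sup>* \<Delta> ,, z \<mapsto> B ,, c \<mapsto> adual A"
    if "fmlookup Ps i = Some Q" "fmlookup As i = Some A" for i Q A
    by (rule ptyp_cong[OF Q[OF that]]) (use assms(4-) in \<open>clarsimp simp: ctx_simps\<close>)
  then have R: "PBra b c Ps \<turnstile>\<^sup>* \<Delta> ,, z \<mapsto> B ,, b \<mapsto> AWith (fmmap adual As)"
    by (intro P_Bra) (use assms(2,4-) in auto)
  show ?thesis
    by (rule ptyp_cut[OF P R]) (use assms(4-) in \<open>(clarsimp simp: ctx_simps)+\<close>)
qed

lemma ptyp_send':
  assumes P: "P \<turnstile>\<^sup>* \<Gamma> ,, c \<mapsto> A" and Q: "Q \<turnstile>\<^sup>* \<Delta> ,, e \<mapsto> (adual A \<otimes> \<bullet>) \<wp> B"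
    and "distinct [a, b, c, d, e, f, g, h, z]"
    and "{a, b, c, d, e, f, g, h, z} \<inter> (keys \<Gamma> \<union> keys \<Delta>) = {}" "keys \<Gamma> \<inter> keys \<Delta> = {}"
  shows "nu a b (PIn a c d P \<parallel> nu e f (Q \<parallel> nu g h (POut f b g \<parallel> PFwd h z)))
    \<turnstile>\<^sup>* \<Gamma> ++\<^sub>f \<Delta> ,, z \<mapsto> B"
proof -
  let ?F = "nu g h (POut f b g \<parallel> PFwd h z)"
  have P': "PIn a c d P \<turnstile>\<^sup>* \<Gamma> ,, a \<mapsto> A \<wp> \<bullet>"
    using P by (rule ptyp_in_bullet) (use assms(3-) in auto)
  have R: "nu e f (Q \<parallel> ?F) \<turnstile>\<^sup>* \<Delta> ,, z \<mapsto> B ,, b \<mapsto> adual A \<otimes> \<bullet>"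
    by (rule ptyp_cut[OF Q ptyp_out_fwd[where A = "adual A \<otimes> \<bullet>" and B = B]])
      (use assms(3-) in \<open>(clarsimp simp: ctx_simps)+\<close>)
  show ?thesis
    by (rule ptyp_cut[OF P' R]) (use assms(3-) in \<open>(clarsimp simp: ctx_simps)+\<close>)
qed

section \<open>Clauses of the buffer translation as derived rules\<close>

lemma ptyp_buf_send:
  assumes P: "P \<turnstile>\<^sup>* \<Gamma> ,, e \<mapsto> A" and Q: "Q \<turnstile>\<^sup>* \<Delta> ,, d \<mapsto> B"
    and "distinct [a, b, c, d, e, f, g, h, x]"
    and "{a, b, c, d, e, f, g, h, x} \<inter> (keys \<Gamma> \<union> keys \<Delta>) = {}" "keys \<Gamma> \<inter> keys \<Delta> = {}"
  shows "nu a b (nu c d (nu g h (PFwd x g \<parallel> POut h a c) \<parallel> PIn b e f P \<parallel> Q))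
    \<turnstile>\<^sup>* \<Gamma> ++\<^sub>f \<Delta> ,, x \<mapsto> (A \<wp> \<bullet>) \<otimes> B"
proof -
  let ?X = "(A \<wp> \<bullet>) \<otimes> B" and ?R = "PIn b e f P \<parallel> Q"
  have P': "PIn b e f P \<turnstile>\<^sup>* \<Gamma> ,, b \<mapsto> A \<wp> \<bullet>"
    using P by (rule ptyp_in_bullet) (use assms(3-) in auto)
  have R: "?R \<turnstile>\<^sup>* \<Gamma> ++\<^sub>f \<Delta> ,, b \<mapsto> A \<wp> \<bullet> ,, d \<mapsto> B"
    by (rule ptyp_cong[OF P_Par[OF P' Q]])
      (use assms(3-) in \<open>(clarsimp simp: ctx_simps)+\<close>)
  have O: "POut h a c \<turnstile>\<^sup>* fmempty ,, a \<mapsto> adual A \<otimes> \<bullet> ,, c \<mapsto> adual B ,, h \<mapsto> ?X"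
    by (rule ptyp_cong[OF ptyp_out[where A = "adual A \<otimes> \<bullet>" and B = "adual B"]])
      (use assms(3-) in \<open>(clarsimp simp: ctx_simps)+\<close>)
  \<comment> \<open>Up to a forwarder this is an output on \<open>x\<close> itself, so
    \<open>x\<close> takes over the type of \<open>h\<close>.\<close>
  have F: "nu g h (PFwd x g \<parallel> POut h a c) \<turnstile>\<^sup>*
      fmempty ,, x \<mapsto> ?X ,, a \<mapsto> adual A \<otimes> \<bullet> ,, c \<mapsto> adual B"
    by (rule ptyp_cut[OF ptyp_fwd[where A = ?X] O])
      (use assms(3-) in \<open>(clarsimp simp: ctx_simps)+\<close>)
  \<comment> \<open>As for pairs, one output holds both \<open>a\<close> and \<open>c\<close>:
    cutting on \<open>c\<close> and \<open>d\<close> brings \<open>a\<close> and \<open>b\<close>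
    into one process.\<close>
  have "nu c d (nu g h (PFwd x g \<parallel> POut h a c) \<parallel> ?R) \<turnstile>\<^sup>*
      \<Gamma> ++\<^sub>f \<Delta> ,, x \<mapsto> ?X ,, a \<mapsto> adual A \<otimes> \<bullet> ,, b \<mapsto> adual (adual A \<otimes> \<bullet>)"
    by (rule ptyp_cut[OF F R]) (use assms(3-) in \<open>(clarsimp simp: ctx_simps)+\<close>)
  then show ?thesis
    by (rule P_Res) (use assms(3-) in \<open>(clarsimp simp: ctx_simps)+\<close>)
qed

lemma ptyp_buf_select:
  assumes P: "P \<turnstile>\<^sup>* \<Gamma> ,, b \<mapsto> A" and "fmlookup As j = Some A"
    and "distinct [a, b, c, d, x]" "{a, b, c, d, x} \<inter> keys \<Gamma> = {}"
  shows "nu a b (nu c d (PFwd x c \<parallel> PSel d a j) \<parallel> P) \<turnstile>\<^sup>* \<Gamma> ,, x \<mapsto> APlus As"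
proof -
  have S: "PSel d a j \<turnstile>\<^sup>* fmempty ,, a \<mapsto> adual A ,, d \<mapsto> APlus As"
    by (rule ptyp_cong[OF P_Sel[OF assms(2)]])
      (use assms(3-) in \<open>(clarsimp simp: ctx_simps)+\<close>)
  have F: "nu c d (PFwd x c \<parallel> PSel d a j) \<turnstile>\<^sup>* fmempty ,, x \<mapsto> APlus As ,, a \<mapsto> adual A"
    by (rule ptyp_cut[OF ptyp_fwd[where A = "APlus As"] S])
      (use assms(3-) in \<open>(clarsimp simp: ctx_simps)+\<close>)
  show ?thesis
    by (rule ptyp_cut[OF F P]) (use assms(3-) in \<open>(clarsimp simp: ctx_simps)+\<close>)
qed

section \<open>Renaming\<close>

text \<open>
  Weakening with \<open>\<bullet>\<close> may add to the context a name that is bound in P, so a key of the context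
  can be shadowed; below such a binder it is no key any more and renaming it has no effect.
\<close>

lemma ren_not_free: "P \<turnstile>\<^sup>* \<Gamma> \<Longrightarrow> x \<notin> keys \<Gamma> \<Longrightarrow> ren P d x = P"
proof (induction rule: ptyp.induct)
  case (P_Bra Ps As \<Gamma> z y)
  have "ren P d x = P" if "fmlookup Ps i = Some P" "x \<noteq> z" for i P
  proof -
    from that(1) P_Bra(1) obtain A where "fmlookup As i = Some A"
      by (metis fmdom'I fmlookup_dom'_iff)
    with P_Bra.IH that P_Bra.prems show ?thesis
      by auto
  qed
  with P_Bra.prems show ?case
    by (auto intro!: fmap_ext simp: map_option_case split: option.splits)
qed auto

lemma finite_namesP [simp]: "finite (namesP P)"
  by (induction P) (auto simp: fmran'_alt_def fmran'I)

text \<open>A lookup in an arbitrary context suits the induction, since the typing rules do not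
  always expose the renamed name as the last update. The two conditions on \<open>d\<close>
  complement each other: a key added by weakening need not occur in \<open>P\<close>, and a bound
  name of \<open>P\<close> need not be a key. Together they keep \<open>d\<close> apart from all
  keys and binders met in the derivation.\<close>

lemma ptyp_ren_drop:
  assumes "P \<turnstile>\<^sup>* \<Gamma>" "fmlookup \<Gamma> x = Some A" "d \<notin> keys \<Gamma>" "d \<notin> namesP P"
  shows "ren P d x \<turnstile>\<^sup>* fmdrop x \<Gamma> ,, d \<mapsto> A"
  using assms
proof (induction arbitrary: A rule: ptyp.induct)
  case P_Nil
  then show ?case by simp
next
  case (P_Bullet P \<Gamma> y)
  show ?case
  proof (cases "x = y")
    case True
    \<comment> \<open>The renamed key was itself introduced by weakening, so the process is
      unchanged and the weakening is repeated with \<open>d\<close>.\<close>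
    with P_Bullet show ?thesis
      by (auto simp: ren_not_free fmdrop_fmupd fmdrop_idle' intro: ptyp.P_Bullet)
  next
    case False
    with P_Bullet have "ren P d x \<turnstile>\<^sup>* fmdrop x \<Gamma> ,, d \<mapsto> A"
      by auto
    then have "ren P d x \<turnstile>\<^sup>* fmdrop x \<Gamma> ,, d \<mapsto> A ,, y \<mapsto> \<bullet>"
      by (rule ptyp.P_Bullet) (use P_Bullet in auto)
    with False P_Bullet show ?thesis
      by (simp add: fmdrop_fmupd fmupd_reorder_neq)
  qed
next
  case (P_Fwd u v B)
  then show ?case
    using ptyp.P_Fwd[of d v B] ptyp.P_Fwd[of u d B]
    by (auto simp: fmdrop_fmupd fmupd_reorder_neq[of v d] split: if_splits)
next
  case (P_Par P \<Gamma> Q \<Delta>)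
  \<comment> \<open>The two contexts are disjoint, so exactly one side owns \<open>x\<close>; on the
    other side the renaming has no effect.\<close>
  show ?case
  proof (cases "x \<in> keys \<Delta>")
    case True
    then have x: "fmlookup \<Delta> x = Some A"
      using P_Par.prems by (auto simp: fmlookup_dom_iff fmlookup_dom'_iff split: if_splits)
    have "x \<notin> keys \<Gamma>"
      using True P_Par.hyps by auto
    moreover have "ren Q d x \<turnstile>\<^sup>* fmdrop x \<Delta> ,, d \<mapsto> A"
      using x P_Par by auto
    ultimately have "P \<parallel> ren Q d x \<turnstile>\<^sup>* \<Gamma> ++\<^sub>f (fmdrop x \<Delta> ,, d \<mapsto> A)"
      using P_Par by (intro ptyp.P_Par) auto
    with \<open>x \<notin> keys \<Gamma>\<close> P_Par.hyps show ?thesis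
      by (simp add: ren_not_free fmdrop_idle')
  next
    case False
    then have x: "fmlookup \<Gamma> x = Some A"
      using P_Par.prems by (auto simp: fmlookup_dom_iff fmlookup_dom'_iff split: if_splits)
    have "ren P d x \<turnstile>\<^sup>* fmdrop x \<Gamma> ,, d \<mapsto> A"
      using x P_Par by auto
    then have "ren P d x \<parallel> Q \<turnstile>\<^sup>* (fmdrop x \<Gamma> ,, d \<mapsto> A) ++\<^sub>f \<Delta>"
      using P_Par False by (intro ptyp.P_Par) auto
    with False P_Par show ?thesis
      by (simp add: ren_not_free fmdrop_idle' fmadd_fmupd_left)
  qed
next
  case (P_Res P \<Gamma> u B v an)
  \<comment> \<open>As a key of \<Gamma>, \<open>x\<close> differs from the restricted names, so
    \<open>ren\<close> does pass under the binder.\<close>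
  then have x: "x \<noteq> u" "x \<noteq> v"
    by (auto simp: fmlookup_dom'_iff)
  have "ren P d x \<turnstile>\<^sup>* fmdrop x (\<Gamma> ,, u \<mapsto> B ,, v \<mapsto> adual B) ,, d \<mapsto> A"
    using P_Res x by auto
  then have "ren P d x \<turnstile>\<^sup>* fmdrop x \<Gamma> ,, d \<mapsto> A ,, u \<mapsto> B ,, v \<mapsto> adual B"
    by (rule ptyp_cong) (use P_Res x in \<open>clarsimp simp: fmdrop_fmupd ctx_simps\<close>)
  then show ?case
    using x P_Res by (auto intro: ptyp.P_Res)
next
  case (P_Out u v w B C)
  then show ?case
    using ptyp.P_Out[of d v w C B] ptyp.P_Out[of u d w C B] ptyp.P_Out[of u v d C B]
    by (auto simp: fmdrop_fmupd fmupd_reorder_neq[of _ d] split: if_splits)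
next
  case (P_In P \<Gamma> v B w C u)
  show ?case
  proof (cases "x = u")
    case True
    \<comment> \<open>The subject may coincide with a name it binds, in which case
      \<open>ren\<close> stops at the binder. Otherwise \<open>x\<close> is no key of the body's
      context. Either way the body is unchanged.\<close>
    with P_In show ?thesis
      by (cases "x \<in> {v, w}")
        (auto simp: ren_not_free fmdrop_fmupd fmdrop_idle' intro: ptyp.P_In)
  next
    case False
    with P_In have x: "x \<noteq> v" "x \<noteq> w"
      by (auto simp: fmlookup_dom'_iff)
    have "ren P d x \<turnstile>\<^sup>* fmdrop x (\<Gamma> ,, v \<mapsto> B ,, w \<mapsto> C) ,, d \<mapsto> A"
      using P_In x False by auto
    then have "ren P d x \<turnstile>\<^sup>* fmdrop x \<Gamma> ,, d \<mapsto> A ,, v \<mapsto> B ,, w \<mapsto> C"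
      by (rule ptyp_cong) (use P_In x in \<open>clarsimp simp: fmdrop_fmupd ctx_simps\<close>)
    then have "PIn u v w (ren P d x) \<turnstile>\<^sup>* fmdrop x \<Gamma> ,, d \<mapsto> A ,, u \<mapsto> B \<wp> C"
      by (rule ptyp.P_In) (use P_In in auto)
    with x False P_In show ?thesis
      by (simp add: fmdrop_fmupd fmupd_reorder_neq)
  qed
next
  case (P_Sel As j B u v)
  then show ?case
    using ptyp.P_Sel[of As j B d v] ptyp.P_Sel[of As j B u d]
    by (auto simp: fmdrop_fmupd fmupd_reorder_neq[of _ d] split: if_splits)
next
  case (P_Bra Ps As \<Gamma> v u)
  show ?case
  proof (cases "x = u")
    case True
    have "ren P d x = P" if "fmlookup Ps i = Some P" "x \<noteq> v" for i P
    proof -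
      from that(1) P_Bra.hyps obtain B where "fmlookup As i = Some B"
        by (metis fmdom'I fmlookup_dom'_iff)
      with that P_Bra.IH P_Bra.hyps True show ?thesis
        by (intro ren_not_free[of P "\<Gamma> ,, v \<mapsto> B"]) auto
    qed
    then have "fmmap (\<lambda>P. ren P d x) Ps = Ps" if "x \<noteq> v"
      using that by (auto intro!: fmap_ext simp: map_option_case split: option.splits)
    moreover have "PBra d v Ps \<turnstile>\<^sup>* \<Gamma> ,, d \<mapsto> AWith As"
      by (rule ptyp.P_Bra) (use P_Bra in auto)
    \<comment> \<open>Again the subject may be shadowed by the bound name \<open>v\<close>, and the
      branches are unchanged in both cases.\<close>
    ultimately show ?thesis
      using True P_Bra by (cases "x = v") (auto simp: fmdrop_fmupd fmdrop_idle')
  next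
    case False
    with P_Bra have x: "x \<noteq> v"
      by (auto simp: fmlookup_dom'_iff)
    have "ren P d x \<turnstile>\<^sup>* fmdrop x \<Gamma> ,, d \<mapsto> A ,, v \<mapsto> B"
      if i: "fmlookup Ps i = Some P" "fmlookup As i = Some B" for i P B
    proof -
      have "d \<notin> namesP P"
        using P_Bra.prems(3) i by (auto dest: fmran'I)
      then have "ren P d x \<turnstile>\<^sup>* fmdrop x (\<Gamma> ,, v \<mapsto> B) ,, d \<mapsto> A"
        using P_Bra.IH i P_Bra.prems x False by auto
      then show ?thesis
        by (rule ptyp_cong)
          (use P_Bra.prems x in \<open>clarsimp simp: fmdrop_fmupd ctx_simps\<close>)
    qed
    then have "PBra u v (fmmap (\<lambda>P. ren P d x) Ps) \<turnstile>\<^sup>* fmdrop x \<Gamma> ,, d \<mapsto> A ,, u \<mapsto> AWith As"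
      by (intro ptyp.P_Bra) (use P_Bra in auto)
    with x False P_Bra show ?thesis
      by (simp add: fmdrop_fmupd fmupd_reorder_neq)
  qed
qed

lemma ptyp_ren:
  assumes "P \<turnstile>\<^sup>* \<Gamma> ,, x \<mapsto> A" "x \<notin> keys \<Gamma>" "d \<notin> keys \<Gamma>" "d \<noteq> x" "d \<notin> namesP P"
  shows "ren P d x \<turnstile>\<^sup>* \<Gamma> ,, d \<mapsto> A"
  using ptyp_ren_drop[OF assms(1), of x A d] assms(2-) by (simp add: fmdrop_fmupd fmdrop_idle')

section \<open>Typing of the translation\<close>

lemma less_fresh: "finite V \<Longrightarrow> v \<in> V \<Longrightarrow> v < fresh V"
  by (auto simp: fresh_def less_Suc_eq_le intro: Max_ge)

text \<open>The forms with \<^term>\<open>Suc\<close> are those to which the simplifier rewrites \<open>k + 1\<close> and \<open>k + 2\<close>.\<close>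

lemma fresh_insert:
  assumes "finite V" "k = fresh (insert z V)"
  shows "z < k" "v \<in> V \<Longrightarrow> v < k" "k \<notin> V" "Suc k \<notin> V" "Suc (Suc k) \<notin> V" "k + i \<notin> V"
  using assms less_fresh[of "insert z V"] by fastforce+

lemma denv_simps [simp]:
  "denv fmempty = fmempty"
  "denv (\<Gamma> ,, x \<mapsto> T) = denv \<Gamma> ,, x \<mapsto> adual (trT T)"
  "denv (\<Gamma> ++\<^sub>f \<Delta>) = denv \<Gamma> ++\<^sub>f denv \<Delta>"
  "keys (denv \<Gamma>) = keys \<Gamma>"
  by (simp_all add: denv_def fmmap_fmupd)

lemma ptyp_tr_Var: "x \<noteq> z \<Longrightarrow> tr_Var x V z \<turnstile>\<^sup>* fmempty ,, x \<mapsto> adual A ,, z \<mapsto> A"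
  by (simp add: tr_Var_def P_Fwd)

text \<open>The premises range over all larger sets \<open>W\<close> and all names outside
  \<open>V\<close>, because the clause picks both itself. The name it picks lies in
  \<open>W\<close>, hence the condition \<open>a \<notin> V\<close>. Abstracting from derivations
  allows \<open>tr_Var\<close> as an argument, as the case construct requires.\<close>

lemma ptyp_tr_App:
  assumes P: "\<And>W a. \<lbrakk>finite W; V \<subseteq> W; a \<notin> V\<rbrakk> \<Longrightarrow> P W a \<turnstile>\<^sup>* \<Gamma> ,, a \<mapsto> (adual A \<otimes> \<bullet>) \<wp> B"
    and Q: "\<And>W e. \<lbrakk>finite W; V \<subseteq> W; e \<notin> V\<rbrakk> \<Longrightarrow> Q W e \<turnstile>\<^sup>* \<Delta> ,, e \<mapsto> A"
    and "finite V" "keys \<Gamma> \<union> keys \<Delta> \<subseteq> V" "z \<notin> keys \<Gamma> \<union> keys \<Delta>" "keys \<Gamma> \<inter> keys \<Delta> = {}"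
  shows "tr_App P Q V z \<turnstile>\<^sup>* \<Gamma> ++\<^sub>f \<Delta> ,, z \<mapsto> B"
proof -
  define k where "k = fresh (insert z V)"
  note k = fresh_insert[OF \<open>finite V\<close> k_def]
  show ?thesis
    unfolding tr_App_def Let_def k_def[symmetric]
    by (rule ptyp_app[OF P Q]) (use assms(3-) k in auto)
qed

lemma ptyp_tr_Pair:
  assumes P: "\<And>W e. \<lbrakk>finite W; V \<subseteq> W; e \<notin> V\<rbrakk> \<Longrightarrow> P W e \<turnstile>\<^sup>* \<Gamma> ,, e \<mapsto> A"
    and Q: "\<And>W g. \<lbrakk>finite W; V \<subseteq> W; g \<notin> V\<rbrakk> \<Longrightarrow> Q W g \<turnstile>\<^sup>* \<Delta> ,, g \<mapsto> B"
    and "finite V" "keys \<Gamma> \<union> keys \<Delta> \<subseteq> V" "z \<notin> keys \<Gamma> \<union> keys \<Delta>" "keys \<Gamma> \<inter> keys \<Delta> = {}"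
  shows "tr_Pair P Q V z \<turnstile>\<^sup>* \<Gamma> ++\<^sub>f \<Delta> ,, z \<mapsto> (A \<wp> \<bullet>) \<otimes> (B \<wp> \<bullet>)"
proof -
  define k where "k = fresh (insert z V)"
  note k = fresh_insert[OF \<open>finite V\<close> k_def]
  show ?thesis
    unfolding tr_Pair_def Let_def k_def[symmetric]
    by (rule ptyp_pair[OF P Q]) (use assms(3-) k in auto)
qed

text \<open>The induction generalizes over \<open>V\<close> and \<open>z\<close>: every clause that
  introduces names enlarges the former, and most move the latter. Bound variables lie in
  \<open>V\<close> so that the new names avoid them.\<close>

lemma ptyp_trM:
  assumes "typM d \<Gamma> M T" "finite V" "keys \<Gamma> \<union> bvM M \<subseteq> V" "z \<notin> keys \<Gamma> \<union> bvM M"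
  shows "trM d V z \<turnstile>\<^sup>* denv \<Gamma> ,, z \<mapsto> trT T"
  using assms
proof (induction arbitrary: V z rule: typM.induct)
  case (T_Var x T)
  then show ?case by (simp add: ptyp_tr_Var)
next
  case (T_Abs d \<Gamma> x T M U)
  define k where "k = fresh (insert z V)"
  note k = fresh_insert[OF T_Abs.prems(1) k_def]
  have "x < k" using T_Abs.prems k(2) by auto
  have P: "trM d W b \<turnstile>\<^sup>* denv \<Gamma> ,, x \<mapsto> adual (trT T) ,, b \<mapsto> trT U"
    if "finite W" "V \<subseteq> W" "b \<notin> V" for W b
    by (rule T_Abs.IH[unfolded trT.simps trS.simps denv_simps]) (use T_Abs.prems that in auto)
  show ?case
    unfolding trM.simps Let_def k_def[symmetric] trT.simps
    by (rule ptyp_abs[OF P]) (use T_Abs k \<open>x < k\<close> in auto)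
next
  case (T_App d \<Gamma> M T U e \<Delta> N)
  have P: "trM d W a \<turnstile>\<^sup>* denv \<Gamma> ,, a \<mapsto> (adual (trT T) \<otimes> \<bullet>) \<wp> trT U"
    if "finite W" "V \<subseteq> W" "a \<notin> V" for W a
    by (rule T_App.IH(1)[unfolded trT.simps trS.simps denv_simps]) (use T_App.prems that in auto)
  have Q: "trM e W a \<turnstile>\<^sup>* denv \<Delta> ,, a \<mapsto> trT T"
    if "finite W" "V \<subseteq> W" "a \<notin> V" for W a
    by (rule T_App.IH(2)[unfolded trT.simps trS.simps denv_simps]) (use T_App.prems that in auto)
  show ?case
    unfolding trM.simps denv_simps
    by (rule ptyp_tr_App[OF P Q]) (use T_App in auto)
next
  case T_Unit
  then show ?case by (simp add: P_Bullet P_Nil)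
next
  case (T_Pair d \<Gamma> M T e \<Delta> N U)
  have P: "trM d W a \<turnstile>\<^sup>* denv \<Gamma> ,, a \<mapsto> trT T"
    if "finite W" "V \<subseteq> W" "a \<notin> V" for W a
    by (rule T_Pair.IH(1)[unfolded trT.simps trS.simps denv_simps]) (use T_Pair.prems that in auto)
  have Q: "trM e W a \<turnstile>\<^sup>* denv \<Delta> ,, a \<mapsto> trT U"
    if "finite W" "V \<subseteq> W" "a \<notin> V" for W a
    by (rule T_Pair.IH(2)[unfolded trT.simps trS.simps denv_simps]) (use T_Pair.prems that in auto)
  show ?case
    unfolding trM.simps trT.simps denv_simps
    by (rule ptyp_tr_Pair[OF P Q]) (use T_Pair in auto)
next
  case (T_Split d \<Gamma> M T T' e \<Delta> x y N U)
  define k where "k = fresh (insert z V)"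
  note k = fresh_insert[OF T_Split.prems(1) k_def]
  have xy: "x < k" "y < k"
    using T_Split.prems k(2) by auto
  have P: "trM d W a \<turnstile>\<^sup>* denv \<Gamma> ,, a \<mapsto> (trT T \<wp> \<bullet>) \<otimes> (trT T' \<wp> \<bullet>)"
    if "finite W" "V \<subseteq> W" "a \<notin> V" for W a
    by (rule T_Split.IH(1)[unfolded trT.simps trS.simps denv_simps])
      (use T_Split.prems that in auto)
  have Q: "trM e W z \<turnstile>\<^sup>* denv \<Delta> ,, x \<mapsto> adual (trT T) ,, y \<mapsto> adual (trT T') ,, z \<mapsto> trT U"
    if "finite W" "V \<subseteq> W" for W
    by (rule T_Split.IH(2)[unfolded trT.simps trS.simps denv_simps])
      (use T_Split.prems that in auto)
  show ?case
    unfolding trM.simps Let_def k_def[symmetric] denv_simps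
    by (rule ptyp_split[OF P Q]) (use T_Split k xy in auto)
next
  case (T_New S)
  define k where "k = fresh (insert z V)"
  note k = fresh_insert[OF T_New.prems(1) k_def]
  \<comment> \<open>The pair of the two endpoints is no premise of the rule, so its translation is
    typed from variables. The double dual at \<open>y\<close> is the shape that \<open>P_Res\<close>
    expects opposite \<open>x\<close>; it is equal to the environment type of \<open>y\<close>
    because \<open>trS\<close> commutes with duality.\<close>
  have P: "tr_Pair (tr_Var x) (tr_Var y) W z \<turnstile>\<^sup>* fmempty ,, z \<mapsto> trT (TProd (TSess S) (TSess (sdual S)))
      ,, x \<mapsto> adual (trS S) ,, y \<mapsto> adual (adual (trS S))"
    if "finite W" "x \<in> W" "y \<in> W" "distinct [x, y, z]" for x y W
    by (rule ptyp_cong[OF ptyp_tr_Pair[OF ptyp_tr_Var[where A = "trS S"] ptyp_tr_Var[where A = "adual (trS S)"]]])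
      (use that in \<open>auto simp: ctx_simps\<close>)
  show ?case
    unfolding trM.simps Let_def k_def[symmetric] denv_simps
    by (intro ptyp_new P_Res[OF P]) (use T_New k in auto)
next
  case (T_Spawn d \<Gamma> M T)
  define k where "k = fresh (insert z V)"
  note k = fresh_insert[OF T_Spawn.prems(1) k_def]
  have P: "trM d W a \<turnstile>\<^sup>* denv \<Gamma> ,, a \<mapsto> (\<bullet> \<wp> \<bullet>) \<otimes> (trT T \<wp> \<bullet>)"
    if "finite W" "V \<subseteq> W" "a \<notin> V" for W a
    by (rule T_Spawn.IH[unfolded trT.simps trS.simps denv_simps]) (use T_Spawn.prems that in auto)
  show ?case
    unfolding trM.simps Let_def k_def[symmetric]
    by (rule ptyp_spawn[OF P]) (use T_Spawn k in auto)
next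
  case (T_EndL d \<Gamma> M T x)
  \<comment> \<open>The type \<open>SEnd\<close> is translated to the self-dual \<bullet>, so
    weakening of terms becomes weakening of processes.\<close>
  then have "trM d V z \<turnstile>\<^sup>* denv \<Gamma> ,, z \<mapsto> trT T ,, x \<mapsto> \<bullet>"
    by (intro P_Bullet) auto
  with T_EndL.prems show ?case
    by (simp add: fmupd_reorder_neq)
next
  case (T_EndR x)
  then show ?case by (simp add: P_Bullet P_Nil)
next
  case (T_Send d \<Gamma> M T S)
  define k where "k = fresh (insert z V)"
  note k = fresh_insert[OF T_Send.prems(1) k_def]
  have P: "trM d W a \<turnstile>\<^sup>* denv \<Gamma> ,, a \<mapsto> (trT T \<wp> \<bullet>) \<otimes> (((adual (trT T) \<otimes> \<bullet>) \<wp> trS S) \<wp> \<bullet>)"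
    if "finite W" "V \<subseteq> W" "a \<notin> V" for W a
    by (rule T_Send.IH[unfolded trT.simps trS.simps denv_simps]) (use T_Send.prems that in auto)
  show ?case
    unfolding trM.simps Let_def k_def[symmetric] trT.simps
    by (rule ptyp_send[OF P]) (use T_Send k in auto)
next
  case (T_Recv d \<Gamma> M T S)
  define k where "k = fresh (insert z V)"
  note k = fresh_insert[OF T_Recv.prems(1) k_def]
  have P: "trM d W a \<turnstile>\<^sup>* denv \<Gamma> ,, a \<mapsto> (trT T \<wp> \<bullet>) \<otimes> trS S"
    if "finite W" "V \<subseteq> W" "a \<notin> V" for W a
    by (rule T_Recv.IH[unfolded trT.simps trS.simps denv_simps]) (use T_Recv.prems that in auto)
  show ?case
    unfolding trM.simps Let_def k_def[symmetric] trT.simps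
    by (rule ptyp_recv[OF P]) (use T_Recv k in auto)
next
  case (T_Select d \<Gamma> M Ss j S)
  define k where "k = fresh (insert z V)"
  note k = fresh_insert[OF T_Select.prems(1) k_def]
  have P: "trM d W a \<turnstile>\<^sup>* denv \<Gamma> ,, a \<mapsto> AWith (fmmap trS Ss)"
    if "finite W" "V \<subseteq> W" "a \<notin> V" for W a
    by (rule T_Select.IH[unfolded trT.simps trS.simps denv_simps]) (use T_Select.prems that in auto)
  show ?case
    unfolding trM.simps Let_def k_def[symmetric] trT.simps
    by (rule ptyp_select[OF P]) (use T_Select k in auto)
next
  case (T_Case d \<Gamma> M Ss Ns es \<Delta> U)
  define k where "k = fresh (insert z V)"
  note k = fresh_insert[OF T_Case.prems(1) k_def]
  have P: "trM d W a \<turnstile>\<^sup>* denv \<Gamma> ,, a \<mapsto> APlus (fmmap trS Ss)"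
    if "finite W" "V \<subseteq> W" "a \<notin> V" for W a
    by (rule T_Case.IH(1)[unfolded trT.simps trS.simps denv_simps]) (use T_Case.prems that in auto)
  have N: "trM e W a \<turnstile>\<^sup>* denv \<Delta> ,, a \<mapsto> (adual (trS S) \<otimes> \<bullet>) \<wp> trT U"
    if "fmlookup es i = Some e" "fmlookup Ss i = Some S" "finite W" "V \<subseteq> W" "a \<notin> V" for W a i e S
  proof -
    from that(2) T_Case.hyps obtain N where N: "fmlookup Ns i = Some N"
      by (metis fmdom'I fmlookup_dom'_iff)
    then have "bvM N \<subseteq> V"
      using T_Case.prems(2) by (auto dest!: fmran'I)
    then have "keys \<Delta> \<union> bvM N \<subseteq> W" "a \<notin> keys \<Delta> \<union> bvM N"
      using that T_Case.prems(2) by auto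
    with N that T_Case.IH(2) show ?thesis
      by simp
  qed
  \<comment> \<open>The argument \<open>c\<close> is new and has no subderivation. It must be
    outside \<open>V\<close> to be disjoint from \<Delta>, and inside \<open>W\<close> so that the
    names chosen within \<open>tr_App\<close> avoid it.\<close>
  have Q: "tr_App (trM e) (tr_Var c) W z \<turnstile>\<^sup>* denv \<Delta> ,, c \<mapsto> adual (trS S) ,, z \<mapsto> trT U"
    if "fmlookup es i = Some e" "fmlookup Ss i = Some S" "finite W" "V \<subseteq> W" "c \<in> W" "c \<notin> V" "c \<noteq> z"
    for W c i e S
    by (rule ptyp_cong[OF ptyp_tr_App[OF N[OF that(1,2)] ptyp_tr_Var]])
      (use that T_Case.prems in auto)
  show ?case
    unfolding trM.simps Let_def k_def[symmetric] denv_simps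
    by (rule ptyp_case[OF P])
      (use T_Case.prems T_Case.hyps k in \<open>auto intro!: Q\<close>)
next
  case (T_Sub d \<Gamma> x T M U e \<Delta> N)
  define k where "k = fresh (insert z V)"
  note k = fresh_insert[OF T_Sub.prems(1) k_def]
  have x: "x < k"
    using T_Sub.prems k(2) by auto
  have P: "trM d W z \<turnstile>\<^sup>* denv \<Gamma> ,, z \<mapsto> trT U ,, x \<mapsto> adual (trT T)"
    if "finite W" "V \<subseteq> W" for W
    by (rule ptyp_cong[OF T_Sub.IH(1)])
      (use T_Sub.prems that in \<open>auto simp: fmupd_reorder_neq\<close>)
  have Q: "trM e W a \<turnstile>\<^sup>* denv \<Delta> ,, a \<mapsto> trT T"
    if "finite W" "V \<subseteq> W" "a \<notin> V" for W a
    by (rule T_Sub.IH(2)[unfolded trT.simps trS.simps denv_simps]) (use T_Sub.prems that in auto)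
  \<comment> \<open>The restriction of \<open>x\<close> also encloses the translation of
    \<open>N\<close>; the side condition that \<open>x\<close> is not in \<Delta> prevents a capture
    there.\<close>
  show ?case
    unfolding trM.simps Let_def k_def[symmetric] denv_simps
    by (rule ptyp_cut[OF P Q]) (use T_Sub k x in \<open>auto simp: ctx_simps\<close>)
next
  case (T_Send' d \<Gamma> M T e \<Delta> N S)
  define k where "k = fresh (insert z V)"
  note k = fresh_insert[OF T_Send'.prems(1) k_def]
  have P: "trM d W c \<turnstile>\<^sup>* denv \<Gamma> ,, c \<mapsto> trT T"
    if "finite W" "V \<subseteq> W" "c \<notin> V" for W c
    by (rule T_Send'.IH(1)[unfolded trT.simps trS.simps denv_simps])
      (use T_Send'.prems that in auto)
  have Q: "trM e W a \<turnstile>\<^sup>* denv \<Delta> ,, a \<mapsto> (adual (trT T) \<otimes> \<bullet>) \<wp> trS S"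
    if "finite W" "V \<subseteq> W" "a \<notin> V" for W a
    by (rule T_Send'.IH(2)[unfolded trT.simps trS.simps denv_simps])
      (use T_Send'.prems that in auto)
  show ?case
    unfolding trM.simps Let_def k_def[symmetric] denv_simps trT.simps
    by (rule ptyp_send'[OF P Q]) (use T_Send' k in auto)
qed

text \<open>Each message moves the continuation to a new endpoint, so the induction generalizes over
  \<open>P\<close>, \<Lambda>, \<open>x\<close> and \<open>V\<close>. The set \<open>V\<close>
  covers \<Lambda> because keys added by weakening need not occur in \<open>P\<close>; the names of
  \<open>P\<close>, including bound ones, are avoided by the choice of \<open>k\<close>, which is
  what the renaming lemma asks for.\<close>

lemma ptyp_trB:
  assumes "typB b \<Gamma> ms S' S" "P \<turnstile>\<^sup>* \<Lambda> ,, x \<mapsto> adual (trS S')" "x \<notin> keys \<Lambda>"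
    and "keys \<Gamma> \<inter> keys \<Lambda> = {}" "x \<notin> keys \<Gamma>" "finite V" "keys \<Gamma> \<union> keys \<Lambda> \<union> bvB ms \<subseteq> V"
  shows "trB b V x P \<turnstile>\<^sup>* denv \<Gamma> ++\<^sub>f \<Lambda> ,, x \<mapsto> adual (trS S)"
  using assms
proof (induction arbitrary: P \<Lambda> x V rule: typB.induct)
  case (T_Buf S')
  then show ?case by simp
next
  case (T_BufSend d \<Gamma> M T b \<Delta> ms S' S)
  define k where "k = fresh (insert x V \<union> namesP P)"
  have k: "x < k" "k + i \<notin> V \<union> namesP P" "k \<notin> V \<union> namesP P"
      "Suc k \<notin> V \<union> namesP P" "Suc (Suc k) \<notin> V \<union> namesP P" for i
    using fresh_insert[of "V \<union> namesP P" k x] T_BufSend.prems by (auto simp: k_def)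
  have M: "trM d W e \<turnstile>\<^sup>* denv \<Gamma> ,, e \<mapsto> trT T" if "finite W" "V \<subseteq> W" "e \<notin> V" for W e
    by (rule ptyp_trM[OF T_BufSend.hyps(1)])
      (use T_BufSend.prems that in \<open>auto simp: bvB_def\<close>)
  have B: "trB b W d' (ren P d' x) \<turnstile>\<^sup>* denv \<Delta> ++\<^sub>f \<Lambda> ,, d' \<mapsto> adual (trS S)"
    if "finite W" "V \<subseteq> W" "d' \<notin> V \<union> namesP P" "d' \<noteq> x" for W d'
    by (rule T_BufSend.IH[OF ptyp_ren[OF T_BufSend.prems(1)]])
      (use T_BufSend.prems that in \<open>auto simp: bvB_def\<close>)
  \<comment> \<open>The context \<Lambda> of the continuation belongs to the remaining buffer, so
    the sum is reassociated; dualizing the type also cancels the dual on the payload.\<close>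
  have *: "denv (\<Gamma> ++\<^sub>f \<Delta>) ++\<^sub>f \<Lambda> ,, x \<mapsto> adual (trS (SSend T S))
    = denv \<Gamma> ++\<^sub>f (denv \<Delta> ++\<^sub>f \<Lambda>) ,, x \<mapsto> (trT T \<wp> \<bullet>) \<otimes> adual (trS S)"
    by simp
  show ?case
    unfolding trB.simps Let_def k_def[symmetric] *
    by (rule ptyp_buf_send[OF M B]) (use T_BufSend.prems T_BufSend.hyps k in auto)
next
  case (T_BufSelect b \<Gamma> ms S' S Ss j)
  define k where "k = fresh (insert x V \<union> namesP P)"
  have k: "x < k" "k + i \<notin> V \<union> namesP P" "k \<notin> V \<union> namesP P"
      "Suc k \<notin> V \<union> namesP P" "Suc (Suc k) \<notin> V \<union> namesP P" for i
    using fresh_insert[of "V \<union> namesP P" k x] T_BufSelect.prems by (auto simp: k_def)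
  have B: "trB b W d' (ren P d' x) \<turnstile>\<^sup>* denv \<Gamma> ++\<^sub>f \<Lambda> ,, d' \<mapsto> adual (trS S)"
    if "finite W" "V \<subseteq> W" "d' \<notin> V \<union> namesP P" "d' \<noteq> x" for W d'
    by (rule T_BufSelect.IH[OF ptyp_ren[OF T_BufSelect.prems(1)]])
      (use T_BufSelect.prems that in \<open>auto simp: bvB_def\<close>)
  show ?case
    unfolding trB.simps Let_def k_def[symmetric] trS.simps adual.simps
    by (rule ptyp_buf_select[OF B]) (use T_BufSelect.prems T_BufSelect.hyps k in auto)
qed

lemma ptyp_trC:
  assumes "typC c \<Gamma> \<phi> C T" "finite V" "keys \<Gamma> \<union> bvC C \<subseteq> V" "z \<notin> keys \<Gamma> \<union> bvC C"
  shows "trC c V z \<turnstile>\<^sup>* denv \<Gamma> ,, z \<mapsto> trT T"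
  using assms
proof (induction arbitrary: V z rule: typC.induct)
  case T_Main
  then show ?case by (auto intro!: ptyp_trM)
next
  case (T_Child d \<Gamma> M)
  show ?case
    unfolding trC.simps by (rule ptyp_trM) (use T_Child in auto)
next
  case (T_ParL c \<Gamma> C d \<Delta> \<phi> D T \<phi>')
  define k where "k = fresh (insert z V)"
  note k = fresh_insert[OF T_ParL.prems(1) k_def]
  \<comment> \<open>A child thread has unit type, hence its result name has type \<bullet> and can
    be closed off with \<open>b\<close>.\<close>
  have P: "nu a b (trC c W a) \<turnstile>\<^sup>* denv \<Gamma>"
    if "finite W" "V \<subseteq> W" "a \<notin> V" "b \<notin> V" "a \<noteq> b" for W a b
    by (intro ptyp_res_bullet T_ParL.IH(1)[unfolded trT.simps])
      (use T_ParL.prems that in auto)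
  have Q: "trC d W z \<turnstile>\<^sup>* denv \<Delta> ,, z \<mapsto> trT T" if "finite W" "V \<subseteq> W" for W
    by (rule T_ParL.IH(2)) (use T_ParL.prems that in auto)
  show ?case
    unfolding trC.simps Let_def k_def[symmetric]
    by (rule ptyp_cong[OF P_Par[OF P Q]]) (use T_ParL.prems T_ParL.hyps k in auto)
next
  case (T_ParR c \<Gamma> \<phi> C T d \<Delta> D \<phi>')
  define k where "k = fresh (insert z V)"
  note k = fresh_insert[OF T_ParR.prems(1) k_def]
  have P: "trC c W z \<turnstile>\<^sup>* denv \<Gamma> ,, z \<mapsto> trT T" if "finite W" "V \<subseteq> W" for W
    by (rule T_ParR.IH(1)) (use T_ParR.prems that in auto)
  have Q: "nu a b (trC d W a) \<turnstile>\<^sup>* denv \<Delta>"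
    if "finite W" "V \<subseteq> W" "a \<notin> V" "b \<notin> V" "a \<noteq> b" for W a b
    by (intro ptyp_res_bullet T_ParR.IH(2)[unfolded trT.simps])
      (use T_ParR.prems that in auto)
  show ?case
    unfolding trC.simps Let_def k_def[symmetric]
    by (rule ptyp_cong[OF P_Par[OF P Q]])
      (use T_ParR.prems T_ParR.hyps k in \<open>auto simp: ctx_simps\<close>)
next
  case (T_Res b \<Gamma> ms S' S c \<Delta> x y \<phi> C T)
  have "trC c V z \<turnstile>\<^sup>* denv (\<Delta> ,, x \<mapsto> TSess S' ,, y \<mapsto> TSess (sdual S)) ,, z \<mapsto> trT T"
    by (rule T_Res.IH) (use T_Res.prems in auto)
  then have C: "trC c V z \<turnstile>\<^sup>* denv \<Delta> ,, y \<mapsto> trS S ,, z \<mapsto> trT T ,, x \<mapsto> adual (trS S')"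
    by (rule ptyp_cong) (use T_Res.prems T_Res.hyps in \<open>clarsimp simp: ctx_simps\<close>)
  \<comment> \<open>The continuation is the whole translated configuration. Its context contains
    \<open>z\<close>, so \<open>z\<close> joins the used names, and \<open>y\<close> remains in it
    as an ordinary key.\<close>
  have "trB b (insert z V) x (trC c V z)
      \<turnstile>\<^sup>* denv \<Gamma> ++\<^sub>f (denv \<Delta> ,, y \<mapsto> trS S ,, z \<mapsto> trT T) ,, x \<mapsto> adual (trS S)"
    by (rule ptyp_trB[OF T_Res.hyps(1) C]) (use T_Res.prems T_Res.hyps in auto)
  \<comment> \<open>The buffer has turned the type of \<open>x\<close> from the dual of
    \<open>S'\<close> into the dual of \<open>S\<close>, so it now matches \<open>y\<close> of type
    \<open>trS S\<close> in the same context.\<close>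
  then show ?case
    unfolding trC.simps
    by (rule ptyp_res[where A = "adual (trS S)"])
      (use T_Res.prems T_Res.hyps in \<open>auto simp: ctx_simps\<close>)
next
  case (T_ResBuf b \<Gamma> y S ms S' c \<Delta> x \<phi> C T)
  have "trC c V z \<turnstile>\<^sup>* denv (\<Delta> ,, x \<mapsto> TSess S') ,, z \<mapsto> trT T"
    by (rule T_ResBuf.IH) (use T_ResBuf.prems in auto)
  then have C: "trC c V z \<turnstile>\<^sup>* denv \<Delta> ,, z \<mapsto> trT T ,, x \<mapsto> adual (trS S')"
    by (rule ptyp_cong)
      (use T_ResBuf.prems T_ResBuf.hyps in \<open>clarsimp simp: ctx_simps\<close>)
  \<comment> \<open>Here \<open>y\<close> comes from a message in the buffer instead of the
    configuration, but it reaches the same context with the same type.\<close>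
  have "trB b (insert z V) x (trC c V z)
      \<turnstile>\<^sup>* denv (\<Gamma> ,, y \<mapsto> TSess (sdual S)) ++\<^sub>f (denv \<Delta> ,, z \<mapsto> trT T) ,, x \<mapsto> adual (trS S)"
    by (rule ptyp_trB[OF T_ResBuf.hyps(1) C]) (use T_ResBuf.prems T_ResBuf.hyps in auto)
  then show ?case
    unfolding trC.simps
    by (rule ptyp_res[where A = "adual (trS S)"])
      (use T_ResBuf.prems T_ResBuf.hyps in \<open>auto simp: ctx_simps\<close>)
next
  case (T_ConfSub c \<Gamma> x T \<phi> C U d \<Delta> M)
  define k where "k = fresh (insert z V)"
  note k = fresh_insert[OF T_ConfSub.prems(1) k_def]
  have x: "x < k"
    using T_ConfSub.prems k(2) by auto
  have P: "trC c W z \<turnstile>\<^sup>* denv \<Gamma> ,, z \<mapsto> trT U ,, x \<mapsto> adual (trT T)"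
    if "finite W" "V \<subseteq> W" for W
    by (rule ptyp_cong[OF T_ConfSub.IH])
      (use T_ConfSub.prems that in \<open>auto simp: fmupd_reorder_neq\<close>)
  have Q: "trM d W a \<turnstile>\<^sup>* denv \<Delta> ,, a \<mapsto> trT T" if "finite W" "V \<subseteq> W" "a \<notin> V" for W a
    by (rule ptyp_trM[OF T_ConfSub.hyps(2)]) (use T_ConfSub.prems that in auto)
  show ?case
    unfolding trC.simps Let_def k_def[symmetric] denv_simps
    by (rule ptyp_cut[OF P Q])
      (use T_ConfSub.prems T_ConfSub.hyps k x in \<open>auto simp: ctx_simps\<close>)
qed

theorem theorem4p4:
  shows
    "(\<forall>d \<Gamma> M T V z.
        typM d \<Gamma> M T \<longrightarrow>
        finite V \<longrightarrow> keys \<Gamma> \<union> bvM M \<subseteq> V \<longrightarrow> z \<notin> keys \<Gamma> \<union> bvM M \<longrightarrow>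
        trM d V z \<turnstile>\<^sup>* denv \<Gamma> ,, z \<mapsto> trT T)
   \<and> (\<forall>d \<Gamma> \<phi> C T V z.
        typC d \<Gamma> \<phi> C T \<longrightarrow>
        finite V \<longrightarrow> keys \<Gamma> \<union> bvC C \<subseteq> V \<longrightarrow> z \<notin> keys \<Gamma> \<union> bvC C \<longrightarrow>
        trC d V z \<turnstile>\<^sup>* denv \<Gamma> ,, z \<mapsto> trT T)
   \<and> (\<forall>d \<Gamma> ms S' S \<Lambda> P V x.
        typB d \<Gamma> ms S' S \<longrightarrow>
        P \<turnstile>\<^sup>* \<Lambda> ,, x \<mapsto> adual (trS S') \<longrightarrow> x \<notin> keys \<Lambda> \<longrightarrow>
        keys \<Gamma> \<inter> keys \<Lambda> = {} \<longrightarrow> x \<notin> keys \<Gamma> \<longrightarrow>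
        finite V \<longrightarrow> keys \<Gamma> \<union> keys \<Lambda> \<union> bvB ms \<subseteq> V \<longrightarrow>
        trB d V x P \<turnstile>\<^sup>* denv \<Gamma> ++\<^sub>f \<Lambda> ,, x \<mapsto> adual (trS S))"
  by (intro conjI allI impI ptyp_trM ptyp_trC ptyp_trB) assumption+

end
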